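(* Let $d\ge 1$, let $P$ be a polytope combinatorially equivalent to the $d$-fold product $\Delta_d\times\cdots\times\Delta_d$ of $d$-dimensional simplices, and let $\pi : P \to \mathbb{R}^d$ be (the restriction of) a linear projection. Then \[ f_0(\pi P) \le f_0(P) - 1 = (d+1)^d - 1. \]
   Context: $f_0$ denotes the number of vertices of a polytope. Two polytopes are combinatorially equivalent if their face lattices are isomorphic; here $P$ need not be the standard Cartesian product, only combinatorially equivalent to it.
   Formalization: The formal theorem assumes d ≥ 2 instead of d ≥ 1: for d = 1 the claim fails, since P = [0,1] with π the identity has f_0(πP) = 2 > 1 = f_0(P) − 1. *)

theory Defs
  imports "HOL-Analysis.Analysis"
begin

definition num_vertices :: "'a::euclidean_space set \<Rightarrow> nat" where
  "num_vertices P = card {v. v extreme_point_of P}"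

text \<open>
  The face lattice of \<open>P\<close> is the set of all its faces, \<open>{}\<close> and \<open>P\<close> included,
  ordered by inclusion.
\<close>

definition combinatorially_equivalent ::
    "'a::euclidean_space set \<Rightarrow> 'b::euclidean_space set \<Rightarrow> bool" where
  "combinatorially_equivalent P Q \<longleftrightarrow>
     (\<exists>\<phi>. bij_betw \<phi> {F. F face_of P} {G. G face_of Q} \<and>
          (\<forall>F F'. F face_of P \<longrightarrow> F' face_of P \<longrightarrow> (F \<subseteq> F' \<longleftrightarrow> \<phi> F \<subseteq> \<phi> F')))"

text \<open>
  The \<open>CARD('n)\<close>-fold Cartesian product \<open>S \<times> \<dots> \<times> S\<close>.  With \<open>S\<close> a \<open>d\<close>-simplex in
  \<open>real ^ 'd\<close>, \<open>d = CARD('d)\<close>, and \<open>'n = 'd\<close> this is the \<open>d\<close>-fold product of \<open>d\<close>-simplices.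
  For \<open>d = 1\<close> it is a segment, which an injective linear map to the line sends to a segment,
  so that no vertex is lost; the bound \<open>f\<^sub>0(\<pi> P) \<le> f\<^sub>0(P) - 1\<close> therefore requires \<open>d \<ge> 2\<close>.
\<close>

definition fold_product :: "'a set \<Rightarrow> ('a ^ 'n) set" where
  "fold_product S = {x. \<forall>i. x $ i \<in> S}"

end

theory Submission
  imports Defs "HOL-Homology.Homology"
begin

text \<open>
  Suppose that no vertex is lost.  Counting vertices, the fibre of the projection over the image
  of each vertex \<open>v\<close> of \<open>P\<close> is \<open>{v}\<close>.  The polytope \<open>P\<close> has \<open>d\<close> classes of \<open>d + 1\<close> facets
  \<open>a\<^sub>i\<^sub>j \<bullet> x \<le> b\<^sub>i\<^sub>j\<close>, and each choice \<open>s\<close> of one facet per class is the set of facets missing some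
  vertex \<open>v\<^sub>s\<close>.  Hence it suffices to find \<open>y \<noteq> 0\<close> in the kernel of the projection, parallel to \<open>P\<close>,
  such that in each class at most one of the numbers \<open>a\<^sub>i\<^sub>j \<bullet> y\<close> is positive: a small step from \<open>v\<^sub>s\<close>
  in the direction \<open>y\<close> then stays in \<open>P\<close>, for \<open>s\<close> choosing the positive ones.

  As \<open>P\<close> has dimension at least \<open>d\<^sup>2\<close>, demanding \<open>a\<^sub>i\<^sub>j \<bullet> y = 0\<close> for all but three \<open>j\<close> in each class
  leaves a space of directions of dimension at least \<open>d\<close>.  The medians of the remaining triples
  are \<open>d\<close> odd functions on it, and Borsuk-Ulam yields a \<open>y \<noteq> 0\<close> at which they all agree, so that
  they are all nonpositive at \<open>y\<close> or at \<open>- y\<close>.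

  Borsuk-Ulam is needed only for piecewise linear maps.  The degree of such an odd self-map of
  the sphere is odd by induction on the dimension: the image of the equator lies in finitely many
  proper subspaces, so the map can be deformed to preserve the equator.
\<close>

subsection \<open>Odd piecewise linear maps of spheres\<close>

text \<open>Points of \<open>nsphere n\<close> are functions on all natural numbers that vanish
  beyond \<open>n\<close>, hence the cut-off. Coordinates of \<open>F\<close> beyond
  \<open>n\<close> are ignored, so one \<open>F\<close> can be normalised in two consecutive
  dimensions, as the induction on the sphere requires.\<close>

definition sphere_normalize :: "nat \<Rightarrow> ('x \<Rightarrow> nat \<Rightarrow> real) \<Rightarrow> 'x \<Rightarrow> nat \<Rightarrow> real" where
  "sphere_normalize n F x = (\<lambda>i. if i \<le> n then F x i / sqrt (\<Sum>j\<le>n. (F x j)\<^sup>2) else 0)"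

lemma in_topspace_nsphere_iff:
  "x \<in> topspace (nsphere n) \<longleftrightarrow> (\<Sum>i\<le>n. (x i)\<^sup>2) = 1 \<and> (\<forall>i>n. x i = 0)"
  by (auto simp: nsphere)

lemma sum_squares_pos:
  assumes "\<exists>i\<le>n. G i \<noteq> (0::real)"
  shows "0 < (\<Sum>j\<le>(n::nat). (G j)\<^sup>2)"
proof -
  obtain i where i: "i \<le> n" "G i \<noteq> 0" using assms by blast
  show ?thesis
    by (rule sum_pos2[of _ i]) (use i in auto)
qed

lemma continuous_map_sphere_normalize:
  assumes "\<And>i. i \<le> n \<Longrightarrow> continuous_map X euclideanreal (\<lambda>x. F x i)"
    and nz: "\<And>x. x \<in> topspace X \<Longrightarrow> \<exists>i\<le>n. F x i \<noteq> 0"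
  shows "continuous_map X (nsphere n) (sphere_normalize n F)"
proof -
  have pos: "0 < (\<Sum>j\<le>n. (F x j)\<^sup>2)" if "x \<in> topspace X" for x
    using nz[OF that] by (rule sum_squares_pos)
  have "continuous_map X euclideanreal (\<lambda>x. sphere_normalize n F x i)" for i
  proof (cases "i \<le> n")
    case True
    have "continuous_map X euclideanreal (\<lambda>x. F x i / sqrt (\<Sum>j\<le>n. (F x j)\<^sup>2))"
      using assms True pos
      by (intro continuous_intros) (auto simp: less_le)
    then show ?thesis
      using True by (simp add: sphere_normalize_def)
  qed (simp add: sphere_normalize_def)
  moreover have "sphere_normalize n F x \<in> {y. (\<Sum>i\<le>n. (y i)\<^sup>2) = 1 \<and> (\<forall>i>n. y i = 0)}"
    if "x \<in> topspace X" for x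
  proof -
    have "(\<Sum>i\<le>n. (sphere_normalize n F x i)\<^sup>2) = (\<Sum>i\<le>n. (F x i)\<^sup>2 / (\<Sum>j\<le>n. (F x j)\<^sup>2))"
      using pos[OF that] by (intro sum.cong) (auto simp: sphere_normalize_def power_divide)
    also have "\<dots> = 1"
      using pos[OF that] by (simp flip: sum_divide_distrib)
    finally show ?thesis by (simp add: sphere_normalize_def)
  qed
  ultimately show ?thesis
    unfolding nsphere
    by (simp add: continuous_map_in_subtopology continuous_map_componentwise_UNIV Pi_iff)
qed

text \<open>Deformations can thus be written down without normalising; only the absence of zeros
  along the way has to be checked.\<close>

lemma Brouwer_degree2_sphere_normalize_homotopy:
  assumes cont: "\<And>i. i \<le> n \<Longrightarrow>
      continuous_map (prod_topology (top_of_set {0..1}) (nsphere n)) euclideanreal (\<lambda>(t,x). h t x i)"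
    and nz: "\<And>t x. t \<in> {0..1::real} \<Longrightarrow> x \<in> topspace (nsphere n) \<Longrightarrow> \<exists>i\<le>n. h t x i \<noteq> 0"
  shows "Brouwer_degree2 n (sphere_normalize n (h 0)) = Brouwer_degree2 n (sphere_normalize n (h 1))"
proof (rule Brouwer_degree2_homotopic)
  have "continuous_map (prod_topology (top_of_set {0..1}) (nsphere n)) (nsphere n)
      (sphere_normalize n (\<lambda>(t,x). h t x))"
    using assms by (intro continuous_map_sphere_normalize) (auto simp: case_prod_unfold)
  then show "homotopic_with (\<lambda>x. True) (nsphere n) (nsphere n)
      (sphere_normalize n (h 0)) (sphere_normalize n (h 1))"
    unfolding homotopic_with_def
    by (intro exI[of _ "sphere_normalize n (\<lambda>(t,x). h t x)"])
       (auto simp: sphere_normalize_def)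
qed

section \<open>A vector outside finitely many proper subspaces\<close>

text \<open>Gaussian elimination: there is one more unknown than there are equations. The solution
  serves as a normal vector to the span of \<open>n\<close> columns of length
  \<open>n + 1\<close>.\<close>

lemma homogeneous_system_nontrivial_solution:
  fixes M :: "nat \<Rightarrow> nat \<Rightarrow> real"
  shows "\<exists>q. (\<exists>i\<le>n. q i \<noteq> 0) \<and> (\<forall>k<n. (\<Sum>i\<le>n. q i * M i k) = 0)"
proof (induction n arbitrary: M)
  case 0
  show ?case by (rule exI[of _ "\<lambda>_. 1"]) auto
next
  case (Suc n)
  show ?case
  proof (cases "\<forall>i\<le>n. M i n = 0")
    case True
    obtain q where q: "\<exists>i\<le>n. q i \<noteq> 0" "\<forall>k<n. (\<Sum>i\<le>n. q i * M i k) = 0"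
      using Suc.IH by blast
    let ?q = "\<lambda>i. if i \<le> n then q i else 0"
    have "(\<Sum>i\<le>n. ?q i * M i k) = (\<Sum>i\<le>n. q i * M i k)" for k
      by (intro sum.cong) auto
    then show ?thesis
      using q True
      by (intro exI[of _ ?q]) (auto simp: less_Suc_eq)
  next
    case False
    then obtain r where r: "r \<le> n" "M r n \<noteq> 0" by blast
    define c where "c i = M i n / M r n" for i
    \<comment> \<open>The pivot unknown \<open>r\<close> is eliminated by the last equation.
      \<open>sw\<close> numbers the remaining unknowns by \<open>0..n\<close>, the last one taking
      the place of \<open>r\<close>.\<close>
    define sw where "sw i = (if i = r then Suc n else i)" for i
    define M' where "M' i k = M (sw i) k - c (sw i) * M r k" for i k
    obtain q where q: "\<exists>i\<le>n. q i \<noteq> 0" "\<forall>k<n. (\<Sum>i\<le>n. q i * M' i k) = 0"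
      using Suc.IH[of M'] by blast
    \<comment> \<open>Back substitution: the entry at \<open>r\<close> is what the last equation
      forces, the other entries come from \<open>q\<close> through \<open>sw\<close>.\<close>
    define p where "p i = (if i = Suc n then q r else if i = r then - (\<Sum>i\<le>n. q i * c (sw i)) else q i)" for i
    have sp: "(\<Sum>i\<le>Suc n. p i * M i k) = (\<Sum>i\<le>n. q i * M' i k)" for k
    proof -
      have "(\<Sum>i\<le>Suc n. p i * M i k)
          = (\<Sum>i\<in>{..n}-{r}. p i * M i k) + p r * M r k + p (Suc n) * M (Suc n) k"
        using r by (simp add: sum.remove[of "{..n}" r])
      also have "(\<Sum>i\<in>{..n}-{r}. p i * M i k) = (\<Sum>i\<in>{..n}-{r}. q i * M (sw i) k)"
        by (intro sum.cong) (auto simp: p_def sw_def)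
      also have "\<dots> + p r * M r k + p (Suc n) * M (Suc n) k
          = (\<Sum>i\<le>n. q i * M (sw i) k) - (\<Sum>i\<le>n. q i * c (sw i)) * M r k"
        using r by (simp add: sum.remove[of "{..n}" r] p_def sw_def algebra_simps)
      also have "\<dots> = (\<Sum>i\<le>n. q i * M' i k)"
        by (simp add: M'_def sum_subtractf sum_distrib_right right_diff_distrib mult.assoc)
      finally show ?thesis .
    qed
    have "M' i n = 0" for i
      using r by (simp add: M'_def c_def)
    then have "\<forall>k<Suc n. (\<Sum>i\<le>Suc n. p i * M i k) = 0"
      using q(2) unfolding sp by (auto simp: less_Suc_eq)
    moreover have "\<exists>i\<le>Suc n. p i \<noteq> 0"
    proof -
      obtain i where "i \<le> n" "q i \<noteq> 0" using q(1) by blast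
      then show ?thesis
        by (intro exI[of _ "if i = r then Suc n else i"]) (auto simp: p_def)
    qed
    ultimately show ?thesis by blast
  qed
qed

text \<open>
  The moment curve meets each of finitely many proper subspaces only finitely often.
\<close>

lemma exists_vector_outside_images:
  fixes \<M> :: "(nat \<Rightarrow> nat \<Rightarrow> real) set"
  assumes "finite \<M>"
  obtains p where "p n = 1"
    and "\<And>M x c. M \<in> \<M> \<Longrightarrow> (\<forall>i\<le>n. c * p i = (\<Sum>k<n. M i k * x k)) \<Longrightarrow> c = 0"
proof -
  \<comment> \<open>\<open>Q M\<close> is a normal vector to the span of the first \<open>n\<close>
    columns of \<open>M\<close>.\<close>
  define Q where "Q M = (SOME q. (\<exists>i\<le>n. q i \<noteq> 0) \<and> (\<forall>k<n. (\<Sum>i\<le>n. q i * M i k) = 0))"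
    for M :: "nat \<Rightarrow> nat \<Rightarrow> real"
  have Q: "\<exists>i\<le>n. Q M i \<noteq> 0" "k < n \<Longrightarrow> (\<Sum>i\<le>n. Q M i * M i k) = 0" for M k
    using someI_ex[OF homogeneous_system_nontrivial_solution, of n M] unfolding Q_def by auto
  have "finite {t. (\<Sum>i\<le>n. Q M (n - i) * t ^ i) = 0}" for M
  proof -
    obtain i where "i \<le> n" "Q M i \<noteq> 0" using Q(1) by blast
    then have "\<exists>k\<le>n. Q M (n - k) \<noteq> 0"
      by (intro exI[of _ "n - i"]) auto
    then show ?thesis
      by (subst polyfun_finite_roots)
  qed
  then have "finite (\<Union>M\<in>\<M>. {t. (\<Sum>i\<le>n. Q M (n - i) * t ^ i) = 0})"
    using assms by blast
  then obtain t where t: "t \<notin> (\<Union>M\<in>\<M>. {t. (\<Sum>i\<le>n. Q M (n - i) * t ^ i) = 0})"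
    using ex_new_if_finite[OF infinite_UNIV_char_0] by blast
  \<comment> \<open>The point of the moment curve at \<open>t\<close>. With decreasing powers its
    last coordinate is 1 for every \<open>t\<close>, and its inner product with \<open>Q M\<close>
    is the polynomial that \<open>t\<close> is not a root of.\<close>
  show ?thesis
  proof (rule that[of "\<lambda>i. t ^ (n - i)"])
    show "t ^ (n - n) = 1" by simp
    fix M x c
    assume M: "M \<in> \<M>" and eq: "\<forall>i\<le>n. c * t ^ (n - i) = (\<Sum>k<n. M i k * x k)"
    have "c * (\<Sum>i\<le>n. Q M i * t ^ (n - i)) = (\<Sum>i\<le>n. Q M i * (c * t ^ (n - i)))"
      by (simp add: sum_distrib_left algebra_simps)
    also have "\<dots> = (\<Sum>i\<le>n. \<Sum>k<n. Q M i * M i k * x k)"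
      using eq by (simp add: sum_distrib_left algebra_simps)
    also have "\<dots> = (\<Sum>k<n. (\<Sum>i\<le>n. Q M i * M i k) * x k)"
      by (subst sum.swap) (simp add: sum_distrib_right)
    also have "\<dots> = 0" by (simp add: Q(2))
    finally have "c * (\<Sum>i\<le>n. Q M i * t ^ (n - i)) = 0" .
    moreover have "(\<Sum>i\<le>n. Q M i * t ^ (n - i)) = (\<Sum>i\<le>n. Q M (n - i) * t ^ i)"
      by (rule sum.reindex_bij_witness[of _ "\<lambda>i. n - i" "\<lambda>i. n - i"]) auto
    ultimately show "c = 0" using t M by auto
  qed
qed


section \<open>Parity of the degree, and Borsuk-Ulam\<close>

text \<open>No polyhedral subdivision is recorded: besides continuity and oddness, it is enough that
  at each point one of finitely many matrices gives the value, since this confines the image of the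
  equator to finitely many proper subspaces.\<close>

definition odd_piecewise_linear :: "nat \<Rightarrow> ((nat \<Rightarrow> real) \<Rightarrow> nat \<Rightarrow> real) \<Rightarrow> bool" where
  "odd_piecewise_linear n F \<longleftrightarrow>
     (\<forall>i\<le>n. continuous_map (nsphere n) euclideanreal (\<lambda>x. F x i)) \<and>
     (\<forall>x\<in>topspace (nsphere n). \<forall>i\<le>n. F (\<lambda>k. - x k) i = - F x i) \<and>
     (\<exists>\<M>. finite \<M> \<and>
        (\<forall>x\<in>topspace (nsphere n). \<exists>M\<in>\<M>. \<forall>i\<le>n. F x i = (\<Sum>k\<le>n. M i k * x k)))"

lemma odd_piecewise_linear_shear:
  assumes "odd_piecewise_linear n F"
  shows "odd_piecewise_linear n (\<lambda>x i. F x i - c i * F x n)"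
  unfolding odd_piecewise_linear_def
proof (intro conjI)
  show "\<forall>i\<le>n. continuous_map (nsphere n) euclideanreal (\<lambda>x. F x i - c i * F x n)"
    using assms unfolding odd_piecewise_linear_def
    by (auto intro!: continuous_intros)
  show "\<forall>x\<in>topspace (nsphere n). \<forall>i\<le>n.
      F (\<lambda>k. - x k) i - c i * F (\<lambda>k. - x k) n = - (F x i - c i * F x n)"
    using assms unfolding odd_piecewise_linear_def by simp
  obtain \<M> where \<M>: "finite \<M>"
      "\<And>x. x \<in> topspace (nsphere n) \<Longrightarrow> \<exists>M\<in>\<M>. \<forall>i\<le>n. F x i = (\<Sum>k\<le>n. M i k * x k)"
    using assms unfolding odd_piecewise_linear_def by blast
  let ?s = "\<lambda>M i k. M i k - c i * M n k"
  have "\<exists>M\<in>?s ` \<M>. \<forall>i\<le>n. F x i - c i * F x n = (\<Sum>k\<le>n. M i k * x k)"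
    if x: "x \<in> topspace (nsphere n)" for x
  proof -
    obtain M where M: "M \<in> \<M>" "\<forall>i\<le>n. F x i = (\<Sum>k\<le>n. M i k * x k)"
      using \<M>(2)[OF x] by blast
    have "F x i - c i * F x n = (\<Sum>k\<le>n. ?s M i k * x k)" if "i \<le> n" for i
      using M(2) that by (simp add: left_diff_distrib sum_subtractf sum_distrib_left mult.assoc)
    then have "\<forall>i\<le>n. F x i - c i * F x n = (\<Sum>k\<le>n. ?s M i k * x k)" by blast
    then show ?thesis using imageI[OF M(1), of ?s] by (rule bexI)
  qed
  then show "\<exists>\<M>. finite \<M> \<and> (\<forall>x\<in>topspace (nsphere n). \<exists>M\<in>\<M>. \<forall>i\<le>n.
      F x i - c i * F x n = (\<Sum>k\<le>n. M i k * x k))"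
    using \<M>(1) by (intro exI[of _ "?s ` \<M>"]) auto
qed

lemma in_topspace_nsphere_equator:
  assumes "x \<in> topspace (nsphere n)"
  shows "x \<in> topspace (nsphere (Suc n))" and "x (Suc n) = 0"
  using assms by (auto simp: in_topspace_nsphere_iff)

lemma odd_piecewise_linear_equator:
  assumes "odd_piecewise_linear (Suc n) F"
  shows "odd_piecewise_linear n F"
  unfolding odd_piecewise_linear_def
proof (intro conjI)
  show "\<forall>i\<le>n. continuous_map (nsphere n) euclideanreal (\<lambda>x. F x i)"
    unfolding subtopology_nsphere_equator[of n, symmetric]
    using assms
    by (auto simp: odd_piecewise_linear_def intro: continuous_map_from_subtopology)
  show "\<forall>x\<in>topspace (nsphere n). \<forall>i\<le>n. F (\<lambda>k. - x k) i = - F x i"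
    using assms in_topspace_nsphere_equator(1) unfolding odd_piecewise_linear_def by auto
  show "\<exists>\<M>. finite \<M> \<and> (\<forall>x\<in>topspace (nsphere n). \<exists>M\<in>\<M>. \<forall>i\<le>n. F x i = (\<Sum>k\<le>n. M i k * x k))"
  proof -
    obtain \<M> where \<M>: "finite \<M>" "\<And>x. x \<in> topspace (nsphere (Suc n)) \<Longrightarrow>
        \<exists>M\<in>\<M>. \<forall>i\<le>Suc n. F x i = (\<Sum>k\<le>Suc n. M i k * x k)"
      using assms unfolding odd_piecewise_linear_def by blast
    have "\<exists>M\<in>\<M>. \<forall>i\<le>n. F x i = (\<Sum>k\<le>n. M i k * x k)" if x: "x \<in> topspace (nsphere n)" for x
    proof -
      obtain M where "M \<in> \<M>" "\<forall>i\<le>Suc n. F x i = (\<Sum>k\<le>Suc n. M i k * x k)"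
        using \<M>(2)[OF in_topspace_nsphere_equator(1)[OF x]] by blast
      then show ?thesis
        using in_topspace_nsphere_equator(2)[OF x] by (intro bexI[of _ M]) auto
    qed
    then show ?thesis using \<M>(1) by blast
  qed
qed

lemma sphere_normalize_minus:
  assumes "\<forall>i\<le>n. F y i = - F x i"
  shows "sphere_normalize n F y = (\<lambda>i. - sphere_normalize n F x i)"
proof -
  have "(\<Sum>j\<le>n. (F y j)\<^sup>2) = (\<Sum>j\<le>n. (F x j)\<^sup>2)"
    using assms by (intro sum.cong) auto
  then show ?thesis
    using assms by (auto simp: sphere_normalize_def)
qed

text \<open>The sphere has only two points, so an odd self-map is the identity or the reflection, of
  degree 1 or -1.\<close>

lemma Brouwer_degree2_odd_sphere_0:
  assumes "f \<in> topspace (nsphere 0) \<rightarrow> topspace (nsphere 0)"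
    and odd: "\<And>x. x \<in> topspace (nsphere 0) \<Longrightarrow> f (\<lambda>i. - x i) = (\<lambda>i. - f x i)"
  shows "odd (Brouwer_degree2 0 f)"
proof -
  define e :: "nat \<Rightarrow> real" where "e = (\<lambda>i. if i = 0 then 1 else 0)"
  have cases: "x = e \<or> x = (\<lambda>i. - e i)" if "x \<in> topspace (nsphere 0)" for x
    using that by (auto simp: in_topspace_nsphere_iff e_def power2_eq_1_iff fun_eq_iff)
  have e: "e \<in> topspace (nsphere 0)"
    by (simp add: e_def in_topspace_nsphere_iff)
  then have "f e = e \<or> f e = (\<lambda>i. - e i)"
    using assms(1) cases by blast
  then show ?thesis
  proof
    assume "f e = e"
    then have "f x = id x" if "x \<in> topspace (nsphere 0)" for x
      using cases[OF that] odd[OF e] by auto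
    then have "Brouwer_degree2 0 f = Brouwer_degree2 0 id"
      by (rule Brouwer_degree2_eq)
    then show ?thesis by simp
  next
    assume "f e = (\<lambda>i. - e i)"
    then have "f x = (\<lambda>i. if i = 0 then - x i else x i)" if "x \<in> topspace (nsphere 0)" for x
      using cases[OF that] odd[OF e] by (auto simp: e_def)
    then have "Brouwer_degree2 0 f = Brouwer_degree2 0 (\<lambda>x i. if i = 0 then - x i else x i)"
      by (rule Brouwer_degree2_eq)
    then show ?thesis by (simp add: Brouwer_degree2_reflection)
  qed
qed

text \<open>Two deformations without zeros lead from \<open>F\<close> to an odd map preserving the
  equator: a shear \<open>G\<close> moves the image of the equator off the last axis, then
  \<open>H\<close> damps the last coordinate to 0 on the equator. By
  \<open>Borsuk_odd_mapping_degree_step\<close> the degree then has the parity of the degree on the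
  equator, where the induction hypothesis applies to \<open>G\<close>.\<close>

theorem odd_Brouwer_degree2_piecewise_linear:
  assumes "odd_piecewise_linear n F"
    and "\<And>x. x \<in> topspace (nsphere n) \<Longrightarrow> \<exists>i\<le>n. F x i \<noteq> 0"
  shows "odd (Brouwer_degree2 n (sphere_normalize n F))"
  using assms
proof (induction n arbitrary: F)
  case 0
  have "continuous_map (nsphere 0) (nsphere 0) (sphere_normalize 0 F)"
    using "0.prems" by (intro continuous_map_sphere_normalize) (auto simp: odd_piecewise_linear_def)
  then show ?case
    using "0.prems"(1)
    by (intro Brouwer_degree2_odd_sphere_0)
       (auto simp: continuous_map_def odd_piecewise_linear_def intro!: sphere_normalize_minus)
next
  case (Suc n)
  let ?S = "nsphere (Suc n)" and ?I = "top_of_set {0..1::real}"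
  have cont_F: "continuous_map ?S euclideanreal (\<lambda>x. F x i)" if "i \<le> Suc n" for i
    using Suc.prems(1) that by (simp add: odd_piecewise_linear_def)
  have cont_lift: "continuous_map (prod_topology ?I ?S) euclideanreal (\<lambda>z. g (snd z))"
    if "continuous_map ?S euclideanreal g" for g
    using continuous_map_compose[OF continuous_map_snd that, of ?I] by (simp add: o_def)
  have cont_t: "continuous_map (prod_topology ?I ?S) euclideanreal fst"
    using continuous_map_compose[OF continuous_map_fst, of ?I euclideanreal id ?S]
    by (simp add: continuous_map_from_subtopology)
  obtain \<M> where \<M>: "finite \<M>"
      "\<And>x. x \<in> topspace ?S \<Longrightarrow> \<exists>M\<in>\<M>. \<forall>i\<le>Suc n. F x i = (\<Sum>k\<le>Suc n. M i k * x k)"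
    using Suc.prems(1) unfolding odd_piecewise_linear_def by blast
  \<comment> \<open>On the equator the last column of each matrix drops out, so \<open>F x\<close>
    lies in one of finitely many proper subspaces. No nonzero multiple of \<open>p\<close> lies in
    any of them.\<close>
  obtain p where p: "p (Suc n) = 1"
    and p_out: "\<And>M x c. M \<in> \<M> \<Longrightarrow> (\<forall>i\<le>Suc n. c * p i = (\<Sum>k<Suc n. M i k * x k)) \<Longrightarrow> c = 0"
    using exists_vector_outside_images[OF \<M>(1)] by blast
  \<comment> \<open>The shear sends \<open>p\<close> to the last axis. The entry 0 of
    \<open>c\<close> at \<open>Suc n\<close> keeps the last coordinate of \<open>F\<close>
    fixed.\<close>
  define c where "c i = (if i = Suc n then 0 else p i)" for i
  define G where "G = (\<lambda>x i. F x i - c i * F x (Suc n))"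
  have G: "odd_piecewise_linear (Suc n) G"
    unfolding G_def using Suc.prems(1) by (rule odd_piecewise_linear_shear)
  then have cont_G: "continuous_map ?S euclideanreal (\<lambda>x. G x i)" if "i \<le> Suc n" for i
    using that by (simp add: odd_piecewise_linear_def)
  \<comment> \<open>The last coordinate does not change with \<open>t\<close>; where it vanishes the
    shear changes nothing, so a zero would be a zero of \<open>F\<close>.\<close>
  have G_nz: "\<exists>i\<le>Suc n. F x i - t * c i * F x (Suc n) \<noteq> 0" if x: "x \<in> topspace ?S" for x t
  proof (rule ccontr)
    assume "\<not> ?thesis"
    then have eq: "F x i = t * c i * F x (Suc n)" if "i \<le> Suc n" for i
      using that by (metis eq_iff_diff_eq_0)
    have "F x (Suc n) = 0" by (subst eq) (simp_all add: c_def)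
    then have "F x i = 0" if "i \<le> Suc n" for i
      using eq[OF that] by (metis mult_zero_right)
    with Suc.prems(2)[OF x] show False by blast
  qed
  have deg_FG: "Brouwer_degree2 (Suc n) (sphere_normalize (Suc n) F)
      = Brouwer_degree2 (Suc n) (sphere_normalize (Suc n) G)"
  proof -
    let ?h = "\<lambda>t x i. F x i - t * c i * F x (Suc n)"
    have "Brouwer_degree2 (Suc n) (sphere_normalize (Suc n) (?h 0))
        = Brouwer_degree2 (Suc n) (sphere_normalize (Suc n) (?h 1))"
    proof (rule Brouwer_degree2_sphere_normalize_homotopy)
      show "continuous_map (prod_topology ?I ?S) euclideanreal (\<lambda>(t, x). ?h t x i)" if "i \<le> Suc n" for i
        unfolding case_prod_unfold
        by (intro continuous_intros cont_lift cont_F cont_t that) auto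
    qed (use G_nz in auto)
    then show ?thesis by (simp add: G_def)
  qed
  \<comment> \<open>Otherwise \<open>F x\<close> would be a multiple of \<open>p\<close>, hence zero
    by the choice of \<open>p\<close>.\<close>
  have equator: "\<exists>i\<le>n. G x i \<noteq> 0" if x: "x \<in> topspace ?S" and x0: "x (Suc n) = 0" for x
  proof (rule ccontr)
    assume "\<not> ?thesis"
    then have eq: "F x i = F x (Suc n) * p i" if "i \<le> Suc n" for i
      using that p by (cases "i = Suc n") (auto simp: G_def c_def)
    obtain M where M: "M \<in> \<M>" "\<forall>i\<le>Suc n. F x i = (\<Sum>k\<le>Suc n. M i k * x k)"
      using \<M>(2)[OF x] by blast
    have "F x (Suc n) * p i = (\<Sum>k<Suc n. M i k * x k)" if "i \<le> Suc n" for i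
      unfolding eq[OF that, symmetric] using M(2) x0 that by (simp add: lessThan_Suc_atMost)
    then have "F x (Suc n) = 0" using p_out M(1) by blast
    then have "F x i = 0" if "i \<le> Suc n" for i
      using eq[OF that] by (metis mult_zero_left)
    with Suc.prems(2)[OF x] show False by blast
  qed
  \<comment> \<open>The factor runs from 1 to the square of the height. A square is even, so oddness
    survives; off the equator the factor is positive, and on the equator \<open>equator\<close>
    already excludes zeros.\<close>
  let ?h = "\<lambda>t x i. if i = Suc n then ((1 - t) + t * (x (Suc n))\<^sup>2) * G x i else G x i"
  define H where "H = ?h 1"
  have h_nz: "\<exists>i\<le>Suc n. ?h t x i \<noteq> 0" if t: "t \<in> {0..1}" and x: "x \<in> topspace ?S" for t x
  proof (cases "\<exists>i\<le>n. G x i \<noteq> 0")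
    case True
    then obtain i where "i \<le> n" "G x i \<noteq> 0" by blast
    then show ?thesis by (intro exI[of _ i]) auto
  next
    case False
    then have x0: "x (Suc n) \<noteq> 0" using equator[OF x] by blast
    have "(1 - t) + t * (x (Suc n))\<^sup>2 > 0"
    proof (cases "t = 1")
      case False
      then show ?thesis using t by (intro add_pos_nonneg) auto
    qed (use x0 in simp)
    moreover have "G x (Suc n) \<noteq> 0"
      using False G_nz[OF x, of 1] by (auto simp: G_def le_Suc_eq)
    ultimately show ?thesis by (intro exI[of _ "Suc n"]) auto
  qed
  have deg_GH: "Brouwer_degree2 (Suc n) (sphere_normalize (Suc n) G)
      = Brouwer_degree2 (Suc n) (sphere_normalize (Suc n) H)"
  proof -
    have "Brouwer_degree2 (Suc n) (sphere_normalize (Suc n) (?h 0))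
        = Brouwer_degree2 (Suc n) (sphere_normalize (Suc n) (?h 1))"
    proof (rule Brouwer_degree2_sphere_normalize_homotopy)
      show "continuous_map (prod_topology ?I ?S) euclideanreal (\<lambda>(t, x). ?h t x i)" if "i \<le> Suc n" for i
      proof (cases "i = Suc n")
        case True
        show ?thesis
          unfolding case_prod_unfold True if_P[OF refl]
          by (intro continuous_intros cont_lift cont_G cont_t continuous_map_nsphere_projection) auto
      next
        case False
        then show ?thesis
          using cont_lift[OF cont_G[OF that]] by (simp add: case_prod_unfold)
      qed
    qed (use h_nz in auto)
    moreover have "?h 0 = G" by (auto simp: fun_eq_iff)
    ultimately show ?thesis by (simp add: H_def)
  qed
  have cm_H: "continuous_map ?S ?S (sphere_normalize (Suc n) H)"
  proof (rule continuous_map_sphere_normalize)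
    show "continuous_map ?S euclideanreal (\<lambda>x. H x i)" if "i \<le> Suc n" for i
      using cont_G[OF that] cont_G[of "Suc n"]
      by (cases "i = Suc n") (auto simp: H_def intro!: continuous_intros continuous_map_nsphere_projection)
    show "\<exists>i\<le>Suc n. H x i \<noteq> 0" if "x \<in> topspace ?S" for x
      using h_nz[of 1 x] that by (simp add: H_def)
  qed
  have H_odd: "sphere_normalize (Suc n) H (\<lambda>i. - x i) = (\<lambda>i. - sphere_normalize (Suc n) H x i)"
    if "x \<in> topspace ?S" for x
    using G that by (intro sphere_normalize_minus) (auto simp: H_def odd_piecewise_linear_def)
  \<comment> \<open>On the equator the last coordinate of \<open>H\<close> is 0, so the two
    normalisations agree there.\<close>
  have H_eq: "sphere_normalize (Suc n) H x = sphere_normalize n G x"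
    if "x \<in> topspace (nsphere n)" for x
    using in_topspace_nsphere_equator(2)[OF that]
    by (auto simp: sphere_normalize_def H_def fun_eq_iff le_Suc_eq)
  have G_equator: "odd_piecewise_linear n G"
    using G by (rule odd_piecewise_linear_equator)
  have G_nz_equator: "\<exists>i\<le>n. G x i \<noteq> 0" if "x \<in> topspace (nsphere n)" for x
    using equator in_topspace_nsphere_equator[OF that] by blast
  have cm_G: "continuous_map (nsphere n) (nsphere n) (sphere_normalize n G)"
    using G_equator G_nz_equator
    by (intro continuous_map_sphere_normalize) (auto simp: odd_piecewise_linear_def)
  have "even (Brouwer_degree2 (Suc n) (sphere_normalize (Suc n) H)
      - Brouwer_degree2 (Suc n - Suc 0) (sphere_normalize (Suc n) H))"
  proof (rule Borsuk_odd_mapping_degree_step[OF cm_H])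
    show "sphere_normalize (Suc n) H \<in> topspace (nsphere (Suc n - Suc 0)) \<rightarrow> topspace (nsphere (Suc n - Suc 0))"
      using cm_G by (auto simp: H_eq continuous_map_def)
  qed (use H_odd in \<open>auto simp: o_def\<close>)
  moreover have "Brouwer_degree2 n (sphere_normalize (Suc n) H) = Brouwer_degree2 n (sphere_normalize n G)"
    by (rule Brouwer_degree2_eq) (rule H_eq)
  moreover have "odd (Brouwer_degree2 n (sphere_normalize n G))"
    using G_equator G_nz_equator by (rule Suc.IH)
  ultimately show ?case
    unfolding deg_FG deg_GH by simp
qed

text \<open>A map without zeros whose last coordinate is 0 normalises to a map that misses the pole.
  It would have degree 0, which is not odd.\<close>

theorem Borsuk_Ulam_piecewise_linear:
  assumes F: "odd_piecewise_linear n F"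
    and F0: "\<And>x. F x n = 0"
  shows "\<exists>x\<in>topspace (nsphere n). \<forall>i<n. F x i = 0"
proof (rule ccontr)
  assume "\<not> ?thesis"
  then have nz: "\<exists>i\<le>n. F x i \<noteq> 0" if "x \<in> topspace (nsphere n)" for x
    using that by (meson less_imp_le)
  have cm: "continuous_map (nsphere n) (nsphere n) (sphere_normalize n F)"
    using F nz by (intro continuous_map_sphere_normalize) (auto simp: odd_piecewise_linear_def)
  define e :: "nat \<Rightarrow> real" where "e = (\<lambda>i. if i = n then 1 else 0)"
  have "e \<in> topspace (nsphere n)"
    by (simp add: e_def in_topspace_nsphere_iff if_distrib[of "\<lambda>x. x\<^sup>2"] cong: if_cong)
  moreover have "e \<notin> sphere_normalize n F ` topspace (nsphere n)"
  proof
    assume "e \<in> sphere_normalize n F ` topspace (nsphere n)"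
    then obtain x where "e = sphere_normalize n F x" by blast
    then have "e n = sphere_normalize n F x n" by simp
    then show False by (simp add: sphere_normalize_def F0 e_def)
  qed
  ultimately have "Brouwer_degree2 n (sphere_normalize n F) = 0"
    using cm by (intro Brouwer_degree2_nonsurjective) auto
  with odd_Brouwer_degree2_piecewise_linear[OF F nz] show False by simp
qed

subsection \<open>Directions along which a vertex moves inside the polytope\<close>

text \<open>The segment from a relative interior point \<open>p\<close> to a point \<open>x\<close>
  outside \<open>P\<close> leaves \<open>P\<close> in a proper face, hence on a hyperplane of index
  \<open>k\<close>. But inequality \<open>k\<close> is strict at \<open>p\<close> and weak at
  \<open>x\<close>, so it is strict at the exit point.\<close>

lemma polytope_eq_affine_hull_Int_halfspaces:
  fixes P :: "'a::euclidean_space set"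
  assumes P: "polytope P"
    and cover: "\<And>C. C face_of P \<Longrightarrow> C \<noteq> P \<Longrightarrow> \<exists>k\<in>K. C \<subseteq> P \<inter> {x. a k \<bullet> x = b k}"
    and le: "\<And>k. k \<in> K \<Longrightarrow> P \<subseteq> {x. a k \<bullet> x \<le> b k}"
    and proper: "\<And>k. k \<in> K \<Longrightarrow> P \<inter> {x. a k \<bullet> x = b k} \<noteq> P"
  shows "P = affine hull P \<inter> (\<Inter>k\<in>K. {x. a k \<bullet> x \<le> b k})"
proof
  show "P \<subseteq> affine hull P \<inter> (\<Inter>k\<in>K. {x. a k \<bullet> x \<le> b k})"
    using le hull_subset[of P affine] by blast
  show "affine hull P \<inter> (\<Inter>k\<in>K. {x. a k \<bullet> x \<le> b k}) \<subseteq> P"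
  proof
    fix x assume "x \<in> affine hull P \<inter> (\<Inter>k\<in>K. {x. a k \<bullet> x \<le> b k})"
    then have x_hull: "x \<in> affine hull P" and x_le: "\<And>k. k \<in> K \<Longrightarrow> a k \<bullet> x \<le> b k" by auto
    then have "P \<noteq> {}" by auto
    then obtain p where p: "p \<in> rel_interior P"
      using polytope_imp_convex[OF P] rel_interior_eq_empty by blast
    then have p_P: "p \<in> P" using rel_interior_subset by blast
    have p_less: "a k \<bullet> p < b k" if "k \<in> K" for k
    proof -
      have "P \<inter> {x. a k \<bullet> x = b k} face_of P"
        using le[OF that] by (intro face_of_Int_supporting_hyperplane_le polytope_imp_convex[OF P]) auto
      then have "p \<notin> {x. a k \<bullet> x = b k}"
        using face_of_disjoint_rel_interior[OF _ proper[OF that]] p p_P by blast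
      then show ?thesis using le[OF that] p_P by force
    qed
    show "x \<in> P"
    proof (rule ccontr)
      assume xP: "x \<notin> P"
      then have "x - p \<noteq> 0" using p_P by auto
      then obtain t where t: "0 < t" and q: "p + t *\<^sub>R (x - p) \<in> rel_frontier P"
        and int: "\<And>e. 0 \<le> e \<Longrightarrow> e < t \<Longrightarrow> p + e *\<^sub>R (x - p) \<in> rel_interior P"
        using ray_to_rel_frontier[OF polytope_imp_bounded[OF P] p, of "x - p"] x_hull by auto
      have "t \<le> 1"
        using int[of 1] xP rel_interior_subset by (force simp: not_le)
      have "p + t *\<^sub>R (x - p) \<in> P"
        using q polytope_imp_closed[OF P] by (auto simp: rel_frontier_def)
      then have "t \<noteq> 1" using xP by auto
      obtain C where "C face_of P" "C \<noteq> P" "p + t *\<^sub>R (x - p) \<in> C"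
        using q unfolding rel_frontier_of_polyhedron_alt[OF polytope_imp_polyhedron[OF P]] by blast
      then obtain k where k: "k \<in> K" "a k \<bullet> (p + t *\<^sub>R (x - p)) = b k"
        using cover by blast
      have "a k \<bullet> (p + t *\<^sub>R (x - p)) = (1 - t) * (a k \<bullet> p) + t * (a k \<bullet> x)"
        by (simp add: inner_right_distrib inner_diff_right algebra_simps)
      also have "\<dots> < (1 - t) * b k + t * b k"
        using t \<open>t \<le> 1\<close> \<open>t \<noteq> 1\<close> p_less[OF k(1)] x_le[OF k(1)]
        by (intro add_less_le_mono mult_strict_left_mono mult_left_mono) auto
      finally show False using k(2) by (simp add: algebra_simps)
    qed
  qed
qed

text \<open>Intersecting with the faces one at a time loses a dimension at each step, because of the
  witness that misses just one of them; \<open>w\<close> remains at the end. This bounds the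
  dimension of \<open>P\<close> from below by incidences alone.\<close>

lemma card_le_aff_dim_face_chain:
  fixes P :: "'a::euclidean_space set"
  assumes "convex P" "finite T"
    and "\<And>k. k \<in> T \<Longrightarrow> F k face_of P"
    and "\<And>k. k \<in> T \<Longrightarrow> \<exists>x\<in>P. x \<notin> F k \<and> (\<forall>l\<in>T - {k}. x \<in> F l)"
    and "w \<in> P" "\<And>k. k \<in> T \<Longrightarrow> w \<in> F k"
  shows "int (card T) \<le> aff_dim P"
proof -
  have "aff_dim (P \<inter> \<Inter>(F ` T)) + int (card T) \<le> aff_dim P"
    using assms(2-4)
  proof (induction T rule: finite_induct)
    case empty
    then show ?case by simp
  next
    case (insert k T)
    have IH: "aff_dim (P \<inter> \<Inter>(F ` T)) + int (card T) \<le> aff_dim P"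
    proof (rule insert.IH)
      show "F l face_of P" if "l \<in> T" for l using insert.prems(1) that by blast
      show "\<exists>x\<in>P. x \<notin> F l \<and> (\<forall>m\<in>T - {l}. x \<in> F m)" if l: "l \<in> T" for l
      proof -
        obtain x where "x \<in> P" "x \<notin> F l" "\<forall>m\<in>insert k T - {l}. x \<in> F m"
          using insert.prems(2)[of l] l by auto
        then show ?thesis by blast
      qed
    qed
    have face: "P \<inter> \<Inter>(F ` T) face_of P"
    proof -
      have "\<Inter>(insert P (F ` T)) face_of P"
        using insert.prems(1) assms(1) by (intro face_of_Inter) (auto simp: face_of_refl)
      then show ?thesis by simp
    qed
    have "P \<inter> \<Inter>(F ` insert k T) face_of P \<inter> \<Inter>(F ` T)"
    proof -
      have "F k \<inter> (P \<inter> \<Inter>(F ` T)) face_of P \<inter> (P \<inter> \<Inter>(F ` T))"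
        using insert.prems(1) by (intro face_of_slice face_of_imp_convex[OF face]) auto
      then show ?thesis by (simp add: Int_left_commute Int_assoc Int_left_absorb)
    qed
    moreover have "P \<inter> \<Inter>(F ` insert k T) \<noteq> P \<inter> \<Inter>(F ` T)"
      using insert.prems(2)[of k] insert.hyps(2) by auto
    ultimately have "aff_dim (P \<inter> \<Inter>(F ` insert k T)) < aff_dim (P \<inter> \<Inter>(F ` T))"
      using face_of_imp_convex[OF face] by (intro face_of_aff_dim_lt)
    then show ?case using IH insert.hyps by simp
  qed
  moreover have "w \<in> P \<inter> \<Inter>(F ` T)" using assms(5,6) by blast
  then have "0 \<le> aff_dim (P \<inter> \<Inter>(F ` T))"
    by (metis aff_dim_negative_iff empty_iff not_le)
  ultimately show ?thesis by linarith
qed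

lemma dim_le_dim_Int_orthogonal:
  fixes D :: "'a::euclidean_space set"
  assumes "subspace D" "finite S"
  shows "dim D \<le> dim (D \<inter> {y. \<forall>x\<in>S. x \<bullet> y = 0}) + card S"
proof -
  let ?E = "{y. \<forall>x\<in>S. x \<bullet> y = 0}"
  have E: "?E = {y \<in> UNIV. \<forall>x\<in>span S. orthogonal x y}"
  proof -
    have "(\<forall>x\<in>S. x \<bullet> y = 0) \<longleftrightarrow> (\<forall>x\<in>span S. orthogonal x y)" for y
      using orthogonal_to_span[of _ S y] span_base[of _ S]
      by (auto simp: orthogonal_def inner_commute)
    then show ?thesis by auto
  qed
  have "subspace ?E"
    by (auto simp: subspace_def inner_right_distrib)
  have "dim ?E + dim (span S) = DIM('a)"
    unfolding E using dim_subspace_orthogonal_to_vectors[of "span S" UNIV] by simp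
  moreover have "dim (span S) \<le> card S"
    using assms(2) by (simp add: dim_le_card')
  moreover have "dim {x + y |x y. x \<in> D \<and> y \<in> ?E} + dim (D \<inter> ?E) = dim D + dim ?E"
    using \<open>subspace D\<close> \<open>subspace ?E\<close> by (rule dim_sums_Int)
  moreover have "dim {x + y |x y. x \<in> D \<and> y \<in> ?E} \<le> DIM('a)"
    by (rule dim_subset_UNIV)
  ultimately show ?thesis by linarith
qed

section \<open>Medians made nonpositive by Borsuk-Ulam\<close>

text \<open>That at most one of three numbers is positive becomes, by a nonpositive median, a sign
  condition on an odd piecewise linear function.\<close>

definition median :: "real \<Rightarrow> real \<Rightarrow> real \<Rightarrow> real" where
  "median a b c = max (min a b) (min (max a b) c)"

lemma median_minus: "median (- a) (- b) (- c) = - median a b c"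
  by (auto simp: median_def min_def max_def)

lemma median_cases: "median a b c = a \<or> median a b c = b \<or> median a b c = c"
  by (auto simp: median_def min_def max_def)

lemma median_nonpos:
  assumes "median a b c \<le> 0"
  shows "a \<le> 0 \<and> b \<le> 0 \<or> a \<le> 0 \<and> c \<le> 0 \<or> b \<le> 0 \<and> c \<le> 0"
  using assms by (auto simp: median_def min_def max_def split: if_splits)

text \<open>
  Borsuk-Ulam is applied to the vector of the medians projected along the diagonal.
\<close>

lemma exists_nonpos_medians:
  fixes W :: "'a::euclidean_space set" and \<alpha> \<beta> \<gamma> :: "'d::finite \<Rightarrow> 'a"
  assumes W: "subspace W" and dimW: "CARD('d) \<le> dim W"
  obtains y where "y \<in> W" "y \<noteq> 0" "\<And>i. median (\<alpha> i \<bullet> y) (\<beta> i \<bullet> y) (\<gamma> i \<bullet> y) \<le> 0"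
proof -
  \<comment> \<open>The unit sphere of a space of dimension \<open>CARD('d)\<close> has dimension
    one less; \<open>y\<close> below carries it into \<open>W\<close> without hitting 0.\<close>
  define n where "n = CARD('d) - 1"
  have n: "{..n} = {..<CARD('d)}"
    by (auto simp: n_def) (metis Suc_pred less_Suc_eq_le zero_less_card_finite)
  obtain e :: "nat \<Rightarrow> 'd" where e: "bij_betw e {..n} UNIV"
    unfolding n using ex_bij_betw_nat_finite[of "UNIV :: 'd set"] by (auto simp: atLeast0LessThan)
  obtain B0 where B0: "B0 \<subseteq> W" "independent B0" "W \<subseteq> span B0" "card B0 = dim W"
    by (rule basis_exists)
  obtain B where B: "B \<subseteq> B0" "card B = CARD('d)" "finite B"
    using obtain_subset_with_card_n[of "CARD('d)" B0] dimW B0(4) by auto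
  obtain w :: "nat \<Rightarrow> 'a" where w: "bij_betw w {..n} B"
    unfolding n B(2)[symmetric] using ex_bij_betw_nat_finite[OF B(3)] by (auto simp: atLeast0LessThan)
  have wW: "w k \<in> W" if "k \<le> n" for k
    using w that B(1) B0(1) by (auto simp: bij_betw_def)
  have "independent B" using B(1) B0(2) by (rule independent_mono[rotated])
  define y where "y x = (\<Sum>k\<le>n. x k *\<^sub>R w k)" for x :: "nat \<Rightarrow> real"
  have yW: "y x \<in> W" for x
    unfolding y_def using wW W by (intro subspace_sum subspace_scale) auto
  have y_nz: "y x \<noteq> 0" if x: "x \<in> topspace (nsphere n)" for x
  proof
    assume "y x = 0"
    have "(\<Sum>b\<in>B. x (inv_into {..n} w b) *\<^sub>R b) = (\<Sum>k\<le>n. x (inv_into {..n} w (w k)) *\<^sub>R w k)"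
      by (rule sum.reindex_bij_betw[OF w, symmetric])
    also have "\<dots> = y x"
      unfolding y_def using w by (intro sum.cong) (auto simp: bij_betw_def)
    finally have "(\<Sum>b\<in>B. x (inv_into {..n} w b) *\<^sub>R b) = 0"
      using \<open>y x = 0\<close> by simp
    then have "x (inv_into {..n} w b) = 0" if "b \<in> B" for b
      using independentD[OF \<open>independent B\<close> B(3) order_refl, of "\<lambda>b. x (inv_into {..n} w b)"] that by simp
    moreover have "w k \<in> B" "inv_into {..n} w (w k) = k" if "k \<le> n" for k
      using w that by (auto simp: bij_betw_def)
    ultimately have "x k = 0" if "k \<le> n" for k
      using that by metis
    then show False using x by (simp add: in_topspace_nsphere_iff)
  qed
  define m where "m i z = median (\<alpha> i \<bullet> z) (\<beta> i \<bullet> z) (\<gamma> i \<bullet> z)" for i z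
  have m_minus: "m i (- z) = - m i z" for i z
    unfolding m_def inner_minus_right by (rule median_minus)
  \<comment> \<open>Coordinate \<open>n\<close> is identically 0, as Borsuk-Ulam demands, and a zero
    of \<open>F\<close> is a point where all medians agree.\<close>
  define F where "F x k = m (e k) (y x) - m (e n) (y x)" for x k
  have "odd_piecewise_linear n F"
    unfolding odd_piecewise_linear_def
  proof (intro conjI)
    have inner_y: "c \<bullet> y x = (\<Sum>k\<le>n. (c \<bullet> w k) * x k)" for c x
      by (simp add: y_def inner_sum_right mult.commute)
    have "continuous_map (nsphere n) euclideanreal (\<lambda>x. c \<bullet> y x)" for c
      unfolding inner_y by (intro continuous_intros continuous_map_nsphere_projection) auto
    then have "continuous_map (nsphere n) euclideanreal (\<lambda>x. m i (y x))" for i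
      unfolding m_def median_def by (intro continuous_intros) auto
    then show "\<forall>i\<le>n. continuous_map (nsphere n) euclideanreal (\<lambda>x. F x i)"
      unfolding F_def by (auto intro!: continuous_intros)
    have "y (\<lambda>k. - x k) = - y x" for x
      by (simp add: y_def sum_negf)
    then show "\<forall>x\<in>topspace (nsphere n). \<forall>i\<le>n. F (\<lambda>k. - x k) i = - F x i"
      by (simp add: F_def m_minus)
    \<comment> \<open>A linear piece is a choice, for each \<open>i\<close>, of the vector that
      attains the median.\<close>
    define C where "C = (\<Pi>\<^sub>E i\<in>UNIV. {\<alpha> i, \<beta> i, \<gamma> i})"
    define mat where "mat c = (\<lambda>i k. (c (e i) - c (e n)) \<bullet> w k)" for c
    have "finite C" unfolding C_def by (intro finite_PiE) auto
    moreover have "\<exists>M\<in>mat ` C. \<forall>i\<le>n. F x i = (\<Sum>k\<le>n. M i k * x k)" for x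
    proof -
      have "\<exists>c\<in>{\<alpha> i, \<beta> i, \<gamma> i}. m i (y x) = c \<bullet> y x" for i
        using median_cases[of "\<alpha> i \<bullet> y x" "\<beta> i \<bullet> y x" "\<gamma> i \<bullet> y x"] by (auto simp: m_def)
      then obtain c where c: "\<And>i. c i \<in> {\<alpha> i, \<beta> i, \<gamma> i}" "\<And>i. m i (y x) = c i \<bullet> y x"
        by metis
      have "F x i = (\<Sum>k\<le>n. mat c i k * x k)" for i
        unfolding F_def c(2) inner_y mat_def
        by (simp add: inner_diff_left left_diff_distrib sum_subtractf)
      moreover have "c \<in> C" using c(1) by (auto simp: C_def)
      ultimately show ?thesis by blast
    qed
    ultimately show "\<exists>\<M>. finite \<M> \<and> (\<forall>x\<in>topspace (nsphere n). \<exists>M\<in>\<M>. \<forall>i\<le>n.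
        F x i = (\<Sum>k\<le>n. M i k * x k))"
      by (intro exI[of _ "mat ` C"]) auto
  qed
  then obtain x where x: "x \<in> topspace (nsphere n)" "\<And>k. k < n \<Longrightarrow> F x k = 0"
    using Borsuk_Ulam_piecewise_linear[of n F] by (auto simp: F_def)
  have eq: "m i (y x) = m (e n) (y x)" for i
  proof -
    obtain k where "k \<le> n" "i = e k" using e by (metis UNIV_I atMost_iff bij_betw_def imageE)
    then show ?thesis using x(2)[of k] by (cases "k = n") (auto simp: F_def)
  qed
  \<comment> \<open>The common value of the medians changes sign with \<open>y x\<close>.\<close>
  show thesis
  proof (cases "m (e n) (y x) \<le> 0")
    case True
    then have "m i (y x) \<le> 0" for i using eq[of i] by simp
    then show thesis
      using that[of "y x"] yW y_nz[OF x(1)] by (simp only: m_def) auto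
  next
    case False
    have "m i (- y x) \<le> 0" for i using False eq[of i] by (simp add: m_minus)
    then show thesis
      using that[of "- y x"] yW y_nz[OF x(1)] subspace_neg[OF W] by (simp only: m_def) auto
  qed
qed

section \<open>A second point in the fibre of a vertex\<close>

text \<open>The hypotheses keep only the incidences of the product: classes of faces
  \<open>F i j\<close>, and points \<open>v s\<close> missing exactly the faces
  \<open>F i (s i)\<close>. With \<open>d = CARD('d)\<close>, at least \<open>d * d\<close>
  dimensions are available; the kernel costs at most \<open>d\<close> and the faces outside a triple
  in each class at most \<open>d * (d - 2)\<close>, which leaves \<open>d\<close> for the
  medians.\<close>

lemma projection_fibre_nontrivial:
  fixes P :: "'a::euclidean_space set" and F :: "'d::finite \<Rightarrow> 'v \<Rightarrow> 'a set"
    and \<pi> :: "'a \<Rightarrow> real ^ 'd"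
  assumes d: "2 \<le> CARD('d)" and P: "polytope P" and V: "card V = CARD('d) + 1"
    and face: "\<And>i j. j \<in> V \<Longrightarrow> F i j face_of P"
    and cover: "\<And>C. C face_of P \<Longrightarrow> C \<noteq> P \<Longrightarrow> \<exists>i. \<exists>j\<in>V. C \<subseteq> F i j"
    and vP: "\<And>s. \<forall>i. s i \<in> V \<Longrightarrow> v s \<in> P"
    and vF: "\<And>s i j. \<forall>i. s i \<in> V \<Longrightarrow> j \<in> V \<Longrightarrow> v s \<in> F i j \<longleftrightarrow> j \<noteq> s i"
    and \<pi>: "linear \<pi>"
  obtains s y where "\<forall>i. s i \<in> V" "y \<noteq> 0" "\<pi> y = 0" "v s + y \<in> P"
proof -
  have finV: "finite V" using V by (metis add_is_0 card.infinite one_neq_zero)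
  \<comment> \<open>Three members exist because \<open>V\<close> has \<open>d + 1\<close> elements
    and \<open>d\<close> is at least 2.\<close>
  obtain J where J: "J \<subseteq> V" "card J = 3" "finite J"
    using obtain_subset_with_card_n[of 3 V] V d by auto
  then obtain j1 j2 j3 where J_eq: "J = {j1, j2, j3}" and "j1 \<noteq> j2" "j1 \<noteq> j3" "j2 \<noteq> j3"
    by (metis card_3_iff)
  have j123: "j1 \<in> V" "j2 \<in> V" "j3 \<in> V" using J(1) J_eq by auto
  have "\<exists>a b. P \<subseteq> {x. a \<bullet> x \<le> b} \<and> F i j = P \<inter> {x. a \<bullet> x = b}" if j: "j \<in> V" for i j
  proof -
    \<comment> \<open>The face is shown nonempty and proper, so that it is cut out by a supporting
      hyperplane.\<close>
    obtain j' where j': "j' \<in> V" "j' \<noteq> j" using j123 \<open>j1 \<noteq> j2\<close> by metis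
    have "F i j \<noteq> {}" using vF[of "\<lambda>_. j'" j i] j j' by auto
    moreover have "F i j \<noteq> P" using vF[of "\<lambda>_. j" j i] vP[of "\<lambda>_. j"] j by auto
    moreover have "F i j exposed_face_of P"
      using face[OF j] exposed_face_of_polyhedron[OF polytope_imp_polyhedron[OF P]] by blast
    ultimately show ?thesis unfolding exposed_face_of by blast
  qed
  then have ex: "\<exists>ab. P \<subseteq> {x. fst ab \<bullet> x \<le> snd ab} \<and> F i j = P \<inter> {x. fst ab \<bullet> x = snd ab}"
    if "j \<in> V" for i j
    using that by fastforce
  define ab where "ab i j = (SOME ab. P \<subseteq> {x. fst ab \<bullet> x \<le> snd ab}
      \<and> F i j = P \<inter> {x. fst ab \<bullet> x = snd ab})" for i j
  define a where "a i j = fst (ab i j)" for i j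
  define b where "b i j = snd (ab i j)" for i j
  have ab: "P \<subseteq> {x. a i j \<bullet> x \<le> b i j}" "F i j = P \<inter> {x. a i j \<bullet> x = b i j}" if "j \<in> V" for i j
    using someI_ex[OF ex[OF that, of i]] unfolding a_def b_def ab_def by auto
  have P_eq: "P = affine hull P \<inter> (\<Inter>k\<in>UNIV \<times> V. {x. (\<lambda>(i,j). a i j) k \<bullet> x \<le> (\<lambda>(i,j). b i j) k})"
  proof (rule polytope_eq_affine_hull_Int_halfspaces[OF P])
    show "\<exists>k\<in>UNIV \<times> V. C \<subseteq> P \<inter> {x. (\<lambda>(i,j). a i j) k \<bullet> x = (\<lambda>(i,j). b i j) k}"
      if "C face_of P" "C \<noteq> P" for C
      using cover[OF that] ab(2) by fastforce
    show "P \<inter> {x. (\<lambda>(i,j). a i j) k \<bullet> x = (\<lambda>(i,j). b i j) k} \<noteq> P" if kV: "k \<in> UNIV \<times> V" for k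
    proof -
      obtain i j where k: "k = (i, j)" "j \<in> V" using kV by auto
      have "F i j \<noteq> P" using vF[of "\<lambda>_. j" j i] vP[of "\<lambda>_. j"] k by auto
      then show ?thesis using ab(2) k by simp
    qed
  qed (use ab(1) in auto)
  define s0 where "s0 = (\<lambda>i::'d. j1)"
  have s0: "\<forall>i. s0 i \<in> V" using j123 by (simp add: s0_def)
  \<comment> \<open>The faces with \<open>j\<close> other than \<open>j1\<close> all contain
    \<open>v s0\<close>. Changing \<open>s0\<close> at \<open>i\<close> to \<open>j\<close> gives a
    point that misses only \<open>F i j\<close> among them.\<close>
  have "int (card (UNIV \<times> (V - {j1}) :: ('d \<times> 'v) set)) \<le> aff_dim P"
  proof (rule card_le_aff_dim_face_chain[where F = "\<lambda>(i,j). F i j" and w = "v s0"])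
    fix k assume "k \<in> (UNIV \<times> (V - {j1}) :: ('d \<times> 'v) set)"
    then obtain i j where k: "k = (i, j)" "j \<in> V" "j \<noteq> j1" by auto
    define s where "s = s0(i := j)"
    have s_eq: "s l = (if l = i then j else j1)" for l by (simp add: s_def s0_def)
    have s: "\<forall>i. s i \<in> V" using j123 k(2) by (simp add: s_eq)
    have vs: "v s \<in> F l m \<longleftrightarrow> m \<noteq> (if l = i then j else j1)" if "m \<in> V" for l m
      unfolding s_eq[of l, symmetric] using s that by (rule vF)
    show "\<exists>x\<in>P. x \<notin> (\<lambda>(i,j). F i j) k \<and>
        (\<forall>l\<in>UNIV \<times> (V - {j1}) - {k}. x \<in> (\<lambda>(i,j). F i j) l)"
      using vP[OF s] k by (intro bexI[of _ "v s"]) (auto simp: vs split: if_splits)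
  qed (use polytope_imp_convex[OF P] finV face vP[OF s0] vF[OF s0] in \<open>auto simp: s0_def\<close>)
  then have dimP: "int (CARD('d) * CARD('d)) \<le> aff_dim P"
    using V j123 by (simp add: card_cartesian_product)
  have a0: "v s0 \<in> affine hull P" using vP[OF s0] by (simp add: hull_inc)
  define D where "D = (+) (- v s0) ` (affine hull P)"
  have subD: "subspace D"
    unfolding D_def using affine_diffs_subspace[OF affine_affine_hull a0] by simp
  have "aff_dim P = int (dim D)"
    unfolding D_def using aff_dim_eq_dim[of "v s0" "affine hull P"] a0
    by (simp only: hull_hull aff_dim_affine_hull)
  then have dimD: "CARD('d) * CARD('d) \<le> dim D"
    using dimP by (simp only: of_nat_le_iff)
  \<comment> \<open>Orthogonality to the adjoint images of the axes puts \<open>y\<close> in the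
    kernel of \<open>\<pi>\<close>; the other vectors make \<open>a i j\<close> vanish on
    \<open>y\<close> for \<open>j\<close> outside the triple.\<close>
  define S where "S = range (\<lambda>i. adjoint \<pi> (axis i 1)) \<union> (\<lambda>(i,j). a i j) ` (UNIV \<times> (V - J))"
  have finS: "finite S" using finV by (simp add: S_def)
  have "card S \<le> CARD('d) + CARD('d) * (CARD('d) - 2)"
  proof -
    have "card S \<le> card (range (\<lambda>i. adjoint \<pi> (axis i 1)))
        + card ((\<lambda>(i,j). a i j) ` (UNIV \<times> (V - J)))"
      unfolding S_def by (rule card_Un_le)
    also have "\<dots> \<le> CARD('d) + card (UNIV \<times> (V - J) :: ('d \<times> 'v) set)"
      using finV by (intro add_mono card_image_le) auto
    also have "card (UNIV \<times> (V - J) :: ('d \<times> 'v) set) = CARD('d) * (CARD('d) - 2)"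
      using J V finV by (simp add: card_cartesian_product card_Diff_subset)
    finally show ?thesis .
  qed
  define W where "W = D \<inter> {y. \<forall>x\<in>S. x \<bullet> y = 0}"
  have "CARD('d) * CARD('d) = CARD('d) + (CARD('d) + CARD('d) * (CARD('d) - 2))"
    using d by (metis add_mult_distrib2 le_add_diff_inverse mult_2_right add.assoc mult.commute)
  then have "CARD('d) \<le> dim W"
    using dim_le_dim_Int_orthogonal[OF subD finS] dimD \<open>card S \<le> _\<close> unfolding W_def by linarith
  moreover have "subspace W"
    unfolding W_def using subD by (auto simp: subspace_def inner_right_distrib)
  ultimately obtain y where y: "y \<in> W" "y \<noteq> 0"
    and med: "\<And>i. median (a i j1 \<bullet> y) (a i j2 \<bullet> y) (a i j3 \<bullet> y) \<le> 0"
    using exists_nonpos_medians[of W "\<lambda>i. a i j1" "\<lambda>i. a i j2" "\<lambda>i. a i j3"] by blast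
  have zero: "a i j \<bullet> y = 0" if "j \<in> V" "j \<notin> J" for i j
    using y(1) that by (auto simp: W_def S_def)
  have "\<pi> y = 0"
  proof -
    have "\<pi> y $ i = 0" for i
    proof -
      have "\<pi> y $ i = axis i 1 \<bullet> \<pi> y" by (simp add: inner_axis')
      also have "\<dots> = adjoint \<pi> (axis i 1) \<bullet> y"
        using adjoint_works[OF \<pi>, of y "axis i 1"] by (simp add: inner_commute)
      also have "\<dots> = 0" using y(1) by (auto simp: W_def S_def)
      finally show ?thesis .
    qed
    then show ?thesis by (simp add: vec_eq_iff)
  qed
  \<comment> \<open>At most one positive value remains in each class, and \<open>s\<close> selects
    it.\<close>
  have "\<exists>k\<in>V. \<forall>j\<in>V. j \<noteq> k \<longrightarrow> a i j \<bullet> y \<le> 0" for i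
  proof -
    have "\<exists>k\<in>J. \<forall>j\<in>J. j \<noteq> k \<longrightarrow> a i j \<bullet> y \<le> 0"
      using median_nonpos[OF med[of i]] unfolding J_eq by blast
    then show ?thesis using zero J(1) by (metis order_refl subsetD)
  qed
  then obtain s where s: "\<forall>i. s i \<in> V" and s_le: "\<And>i j. j \<in> V \<Longrightarrow> j \<noteq> s i \<Longrightarrow> a i j \<bullet> y \<le> 0"
    by metis
  \<comment> \<open>At \<open>v s\<close> the inequalities selected by \<open>s\<close> are strict
    and all others are equalities, so a short step along \<open>y\<close> violates none.\<close>
  have slack: "0 < b i (s i) - a i (s i) \<bullet> v s" for i
    using vF[OF s, of "s i" i] vP[OF s] ab[of "s i" i] s by force
  have "\<exists>\<epsilon>>0. \<epsilon> * (a i (s i) \<bullet> y) \<le> b i (s i) - a i (s i) \<bullet> v s" for i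
  proof (cases "a i (s i) \<bullet> y \<le> 0")
    case True
    then show ?thesis using slack[of i] by (intro exI[of _ 1]) auto
  next
    case False
    then show ?thesis
      using slack[of i]
      by (intro exI[of _ "(b i (s i) - a i (s i) \<bullet> v s) / (a i (s i) \<bullet> y)"]) auto
  qed
  then obtain \<epsilon> where \<epsilon>: "\<And>i. \<epsilon> i > 0"
      "\<And>i. \<epsilon> i * (a i (s i) \<bullet> y) \<le> b i (s i) - a i (s i) \<bullet> v s"
    by metis
  define \<delta> where "\<delta> = Min (range \<epsilon>)"
  have \<delta>: "\<delta> > 0" "\<And>i. \<delta> \<le> \<epsilon> i"
    using \<epsilon>(1) by (auto simp: \<delta>_def)
  have "v s + \<delta> *\<^sub>R y \<in> P"
  proof -
    have "v s0 + y \<in> affine hull P"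
      using y(1) by (auto simp: W_def D_def)
    \<comment> \<open>\<open>y\<close> is a difference of two points of the affine hull, so moving
      along it stays in the hull.\<close>
    then have "v s + \<delta> *\<^sub>R ((v s0 + y) - v s0) \<in> affine hull P"
      using a0 hull_inc[OF vP[OF s], of affine] by (intro mem_affine_3_minus) auto
    moreover have "a i j \<bullet> (v s + \<delta> *\<^sub>R y) \<le> b i j" if j: "j \<in> V" for i j
    proof (cases "j = s i")
      case False
      then have "a i j \<bullet> v s = b i j" using vF[OF s j, of i] ab(2)[OF j] by auto
      then show ?thesis
        using s_le[OF j False] \<delta>(1) by (simp add: inner_right_distrib mult_nonneg_nonpos)
    next
      case True
      show ?thesis
      proof (cases "a i j \<bullet> y \<le> 0")
        case True
        then have "\<delta> * (a i j \<bullet> y) \<le> 0" using \<delta>(1) by (simp add: mult_nonneg_nonpos)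
        then show ?thesis using slack[of i] \<open>j = s i\<close> by (simp add: inner_right_distrib)
      next
        case False
        then have "\<delta> * (a i j \<bullet> y) \<le> \<epsilon> i * (a i j \<bullet> y)"
          using \<delta>(2) by (intro mult_right_mono) auto
        then show ?thesis using \<epsilon>(2)[of i] \<open>j = s i\<close> by (simp add: inner_right_distrib)
      qed
    qed
    ultimately show ?thesis by (subst P_eq) auto
  qed
  moreover have "\<pi> (\<delta> *\<^sub>R y) = 0" using \<open>\<pi> y = 0\<close> by (simp add: linear_cmul[OF \<pi>])
  ultimately show thesis using that[OF s, of "\<delta> *\<^sub>R y"] y(2) \<delta>(1) by simp
qed

subsection \<open>Face lattices and products of simplices\<close>

lemma convex_fold_product: "convex S \<Longrightarrow> convex (fold_product S)"
  by (auto simp: fold_product_def convex_def)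

lemma compact_fold_product:
  fixes S :: "'a::euclidean_space set"
  assumes "compact S"
  shows "compact (fold_product S :: ('a ^ 'n) set)"
  unfolding compact_eq_bounded_closed
proof
  obtain B where B: "\<And>x. x \<in> S \<Longrightarrow> norm x \<le> B"
    using compact_imp_bounded[OF assms] unfolding bounded_iff by blast
  have "norm x \<le> (\<Sum>i\<in>(UNIV :: 'n set). B)" if "x \<in> fold_product S" for x :: "'a ^ 'n"
  proof -
    have "norm x \<le> (\<Sum>i\<in>UNIV. norm (x $ i))"
      unfolding norm_vec_def by (rule L2_set_le_sum) simp
    also have "\<dots> \<le> (\<Sum>i\<in>(UNIV :: 'n set). B)"
      using that B by (intro sum_mono) (auto simp: fold_product_def)
    finally show ?thesis .
  qed
  then show "bounded (fold_product S :: ('a ^ 'n) set)"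
    unfolding bounded_iff by blast
  have "fold_product S = (\<Inter>i. (\<lambda>x :: 'a ^ 'n. x $ i) -` S)"
    by (auto simp: fold_product_def)
  then show "closed (fold_product S :: ('a ^ 'n) set)"
    using compact_imp_closed[OF assms]
    by (auto intro!: closed_INT closed_vimage continuous_intros)
qed

lemma extreme_point_of_fold_product:
  fixes S :: "'a::euclidean_space set" and x :: "'a ^ 'n"
  shows "x extreme_point_of fold_product S \<longleftrightarrow> (\<forall>i. x $ i extreme_point_of S)"
proof
  assume x: "x extreme_point_of fold_product S"
  then have xS: "x $ i \<in> S" for i
    by (auto simp: extreme_point_of_def fold_product_def)
  show "\<forall>i. x $ i extreme_point_of S"
  proof
    fix i
    have False if ab: "a \<in> S" "b \<in> S" "x $ i \<in> open_segment a b" for a b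
    proof -
      define upd where "upd c = (\<chi> k. if k = i then c else x $ k)" for c
      have "upd a \<in> fold_product S" "upd b \<in> fold_product S"
        using ab xS by (auto simp: upd_def fold_product_def)
      moreover have "x \<in> open_segment (upd a) (upd b)"
      proof -
        obtain u where u: "a \<noteq> b" "0 < u" "u < 1" "x $ i = (1 - u) *\<^sub>R a + u *\<^sub>R b"
          using ab(3) by (auto simp: in_segment)
        have "x = (1 - u) *\<^sub>R upd a + u *\<^sub>R upd b"
          using u(4) by (auto simp: vec_eq_iff upd_def algebra_simps)
        moreover have "upd a \<noteq> upd b"
          using u(1) by (auto simp: vec_eq_iff upd_def)
        ultimately show ?thesis using u(2,3) unfolding in_segment by blast
      qed
      ultimately show False using x by (auto simp: extreme_point_of_def)
    qed
    then show "x $ i extreme_point_of S"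
      using xS by (auto simp: extreme_point_of_def)
  qed
next
  assume x: "\<forall>i. x $ i extreme_point_of S"
  have False if ab: "a \<in> fold_product S" "b \<in> fold_product S" "x \<in> open_segment a b" for a b
  proof -
    obtain u where u: "a \<noteq> b" "0 < u" "u < 1" "x = (1 - u) *\<^sub>R a + u *\<^sub>R b"
      using ab(3) by (auto simp: in_segment)
    obtain i where "a $ i \<noteq> b $ i" using u(1) by (auto simp: vec_eq_iff)
    moreover have "x $ i = (1 - u) *\<^sub>R (a $ i) + u *\<^sub>R (b $ i)" using u(4) by simp
    ultimately have "x $ i \<in> open_segment (a $ i) (b $ i)"
      using u(2,3) unfolding in_segment by blast
    then show False
      using x ab(1,2) by (auto simp: extreme_point_of_def fold_product_def)
  qed
  then show "x extreme_point_of fold_product S"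
    using x by (auto simp: extreme_point_of_def fold_product_def)
qed

lemma face_of_fold_product_slice:
  assumes "T face_of S" "convex S"
  shows "{x \<in> fold_product S. x $ i \<in> T} face_of fold_product S"
  unfolding face_of_def
proof (intro conjI ballI impI)
  show "{x \<in> fold_product S. x $ i \<in> T} \<subseteq> fold_product S" by blast
  show "convex {x \<in> fold_product S. x $ i \<in> T}"
  proof (rule convexI)
    fix x y and u w :: real
    assume "x \<in> {x \<in> fold_product S. x $ i \<in> T}" "y \<in> {x \<in> fold_product S. x $ i \<in> T}"
      and "0 \<le> u" "0 \<le> w" "u + w = 1"
    then show "u *\<^sub>R x + w *\<^sub>R y \<in> {x \<in> fold_product S. x $ i \<in> T}"
      using convexD[OF convex_fold_product[OF assms(2)], of x y u w]
        convexD[OF face_of_imp_convex[OF assms(1)], of "x $ i" "y $ i" u w] by simp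
  qed
  fix a b x
  assume a: "a \<in> fold_product S" and b: "b \<in> fold_product S"
    and x: "x \<in> {x \<in> fold_product S. x $ i \<in> T}" "x \<in> open_segment a b"
  obtain u where u: "0 < u" "u < 1" "x = (1 - u) *\<^sub>R a + u *\<^sub>R b"
    using x(2) by (auto simp: in_segment)
  have xi: "x $ i = (1 - u) *\<^sub>R (a $ i) + u *\<^sub>R (b $ i)" using u(3) by simp
  \<comment> \<open>The open segment between coordinates is empty when they coincide, so this case
    does not follow from the face property of \<open>T\<close>.\<close>
  have "a $ i \<in> T \<and> b $ i \<in> T"
  proof (cases "a $ i = b $ i")
    case True
    then have "x $ i = a $ i" using xi by (simp add: algebra_simps)
    then show ?thesis using x(1) True by simp
  next
    case False
    then have "x $ i \<in> open_segment (a $ i) (b $ i)" using xi u(1,2) unfolding in_segment by blast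
    then show ?thesis
      using face_ofD[OF assms(1)] x(1) a b by (auto simp: fold_product_def)
  qed
  then show "a \<in> {x \<in> fold_product S. x $ i \<in> T}" "b \<in> {x \<in> fold_product S. x $ i \<in> T}"
    using a b by auto
qed

text \<open>A relative interior point \<open>z\<close> of \<open>C\<close> cannot have all
  coordinates interior to the simplex, as it would then be interior to the product. A coordinate on
  the boundary lies in some \<open>convex hull (V - {j})\<close>, and a face of the product
  containing \<open>z\<close> contains all of \<open>C\<close>.\<close>

lemma proper_face_of_fold_product_simplex:
  fixes V :: "'a::euclidean_space set" and C :: "('a ^ 'n) set"
  assumes V: "\<not> affine_dependent V" "card V = DIM('a) + 1"
    and C: "C face_of fold_product (convex hull V)" "C \<noteq> fold_product (convex hull V)"
  shows "\<exists>i. \<exists>j\<in>V. C \<subseteq> {x \<in> fold_product (convex hull V). x $ i \<in> convex hull (V - {j})}"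
proof (rule ccontr)
  assume neg: "\<not> ?thesis"
  have finV: "finite V" using V(1) by (rule aff_independent_finite)
  have "V \<noteq> {}" using V(2) by auto
  then obtain j0 where "j0 \<in> V" by blast
  with neg have "C \<noteq> {}" by blast
  then obtain z where z: "z \<in> rel_interior C"
    using face_of_imp_convex[OF C(1)] rel_interior_eq_empty by blast
  have zC: "z \<in> C" using z rel_interior_subset by blast
  \<comment> \<open>The simplex is full-dimensional, so its relative interior is open.\<close>
  have "aff_dim V = DIM('a)" using aff_dim_affine_independent[OF V(1)] V(2) by simp
  then have rel: "rel_interior (convex hull V) = interior (convex hull V)"
    by (intro rel_interior_interior) (simp add: affine_hull_convex_hull flip: aff_dim_eq_full)
  have "z $ i \<in> interior (convex hull V)" for i
  proof (rule ccontr)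
    assume "z $ i \<notin> interior (convex hull V)"
    moreover have zi: "z $ i \<in> convex hull V"
      using zC face_of_imp_subset[OF C(1)] by (auto simp: fold_product_def)
    ultimately have "z $ i \<in> rel_frontier (convex hull V)"
      unfolding rel[symmetric] rel_frontier_def using closure_subset by blast
    then obtain T where T: "T face_of convex hull V" "T \<noteq> convex hull V" "z $ i \<in> T"
      using rel_frontier_of_polyhedron_alt[OF polyhedron_convex_hull[OF finV]] by blast
    then obtain c where c: "c \<subseteq> V" "T = convex hull c"
      using face_of_convex_hull_affine_independent[OF V(1)] by blast
    with T(2) have "c \<noteq> V" by auto
    with c(1) obtain j where j: "j \<in> V" "c \<subseteq> V - {j}" by blast
    let ?G = "{x \<in> fold_product (convex hull V). x $ i \<in> convex hull (V - {j})}"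
    have "z \<in> ?G"
      using zC face_of_imp_subset[OF C(1)] T(3) c(2) hull_mono[OF j(2), of convex] by blast
    moreover have "convex hull (V - {j}) face_of convex hull V"
      using face_of_convex_hull_affine_independent[OF V(1)] by blast
    then have "?G face_of fold_product (convex hull V)"
      by (rule face_of_fold_product_slice) (rule convex_convex_hull)
    ultimately have "C \<subseteq> ?G"
      using subset_of_face_of[OF _ face_of_imp_subset[OF C(1)], of ?G] z by blast
    with neg j(1) show False by blast
  qed
  then have "z \<in> fold_product (interior (convex hull V))" by (simp add: fold_product_def)
  moreover have "fold_product (interior (convex hull V)) = (\<Inter>i. (\<lambda>x :: 'a ^ 'n. x $ i) -` interior (convex hull V))"
    by (auto simp: fold_product_def)
  then have "open (fold_product (interior (convex hull V)) :: ('a ^ 'n) set)"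
    by (auto intro!: open_INT open_vimage continuous_intros)
  moreover have "fold_product (interior (convex hull V)) \<subseteq> fold_product (convex hull V)"
    using interior_subset[of "convex hull V"] by (auto simp: fold_product_def)
  ultimately have "z \<in> interior (fold_product (convex hull V))"
    by (meson interior_maximal subsetD)
  then show False
    using face_of_disjoint_interior[OF C] zC by blast
qed

lemma card_fold_product:
  assumes "finite V"
  shows "card (fold_product V :: ('a ^ 'n) set) = card V ^ CARD('n)"
proof -
  have "bij_betw vec_nth (fold_product V :: ('a ^ 'n) set) (\<Pi>\<^sub>E i\<in>UNIV. V)"
    by (rule bij_betw_byWitness[where f' = vec_lambda]) (auto simp: fold_product_def)
  then show ?thesis
    by (simp add: bij_betw_same_card card_PiE)
qed

section \<open>Isomorphisms of face lattices\<close>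

text \<open>The map hidden in \<open>combinatorially_equivalent\<close> becomes a parameter, so that
  it can be inverted and applied to particular faces.\<close>

definition face_lattice_iso ::
    "('a::euclidean_space set \<Rightarrow> 'b::euclidean_space set) \<Rightarrow> 'a set \<Rightarrow> 'b set \<Rightarrow> bool" where
  "face_lattice_iso \<phi> P Q \<longleftrightarrow> bij_betw \<phi> {F. F face_of P} {G. G face_of Q} \<and>
     (\<forall>F F'. F face_of P \<longrightarrow> F' face_of P \<longrightarrow> (F \<subseteq> F' \<longleftrightarrow> \<phi> F \<subseteq> \<phi> F'))"

lemma face_lattice_iso_inverse:
  assumes "face_lattice_iso \<phi> P Q"
  obtains \<psi> where "face_lattice_iso \<psi> Q P"
    "\<forall>F. F face_of P \<longrightarrow> \<psi> (\<phi> F) = F" "\<forall>G. G face_of Q \<longrightarrow> \<phi> (\<psi> G) = G"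
proof -
  let ?\<psi> = "inv_into {F. F face_of P} \<phi>"
  have bij: "bij_betw \<phi> {F. F face_of P} {G. G face_of Q}"
    using assms by (simp add: face_lattice_iso_def)
  have bij': "bij_betw ?\<psi> {G. G face_of Q} {F. F face_of P}"
    using bij by (rule bij_betw_inv_into)
  have \<phi>\<psi>: "\<phi> (?\<psi> G) = G" if "G face_of Q" for G
    using bij that by (simp add: bij_betw_inv_into_right)
  have \<psi>\<phi>: "?\<psi> (\<phi> F) = F" if "F face_of P" for F
    using bij that by (simp add: bij_betw_inv_into_left)
  have face: "?\<psi> G face_of P" if "G face_of Q" for G
    using bij' that by (auto simp: bij_betw_def)
  have "G \<subseteq> G' \<longleftrightarrow> ?\<psi> G \<subseteq> ?\<psi> G'" if "G face_of Q" "G' face_of Q" for G G'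
  proof -
    have "?\<psi> G \<subseteq> ?\<psi> G' \<longleftrightarrow> \<phi> (?\<psi> G) \<subseteq> \<phi> (?\<psi> G')"
      using assms face that unfolding face_lattice_iso_def by blast
    then show ?thesis by (simp add: \<phi>\<psi> that)
  qed
  then have "face_lattice_iso ?\<psi> Q P"
    using bij' by (simp add: face_lattice_iso_def)
  then show thesis using that[of ?\<psi>] \<phi>\<psi> \<psi>\<phi> by blast
qed

lemma face_lattice_iso_face:
  "face_lattice_iso \<phi> P Q \<Longrightarrow> F face_of P \<Longrightarrow> \<phi> F face_of Q"
  by (auto simp: face_lattice_iso_def bij_betw_def)

lemma face_lattice_iso_subset_iff:
  "face_lattice_iso \<phi> P Q \<Longrightarrow> F face_of P \<Longrightarrow> F' face_of P \<Longrightarrow> \<phi> F \<subseteq> \<phi> F' \<longleftrightarrow> F \<subseteq> F'"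
  by (auto simp: face_lattice_iso_def)

lemma face_lattice_iso_empty:
  assumes "face_lattice_iso \<phi> P Q"
  shows "\<phi> {} = {}"
proof -
  obtain \<psi> where \<psi>: "face_lattice_iso \<psi> Q P"
      "\<forall>F. F face_of P \<longrightarrow> \<psi> (\<phi> F) = F" "\<forall>G. G face_of Q \<longrightarrow> \<phi> (\<psi> G) = G"
    by (rule face_lattice_iso_inverse[OF assms])
  have "\<phi> {} \<subseteq> \<phi> (\<psi> {})"
    using face_lattice_iso_subset_iff[OF assms empty_face_of face_lattice_iso_face[OF \<psi>(1) empty_face_of]]
    by blast
  then show ?thesis using \<psi>(3)[rule_format, of "{}"] by simp
qed

lemma face_lattice_iso_top:
  assumes "face_lattice_iso \<phi> P Q" "convex P" "convex Q"
  shows "\<phi> P = Q"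
proof
  show "\<phi> P \<subseteq> Q"
    using face_of_imp_subset[OF face_lattice_iso_face[OF assms(1) face_of_refl[OF assms(2)]]] .
  obtain \<psi> where \<psi>: "face_lattice_iso \<psi> Q P"
      "\<forall>F. F face_of P \<longrightarrow> \<psi> (\<phi> F) = F" "\<forall>G. G face_of Q \<longrightarrow> \<phi> (\<psi> G) = G"
    by (rule face_lattice_iso_inverse[OF assms(1)])
  have "\<psi> Q face_of P"
    using face_lattice_iso_face[OF \<psi>(1)] assms(3) by (simp add: face_of_refl)
  then have "\<phi> (\<psi> Q) \<subseteq> \<phi> P"
    using face_lattice_iso_subset_iff[OF assms(1)] assms(2) face_of_imp_subset by (blast intro: face_of_refl)
  then show "Q \<subseteq> \<phi> P" using \<psi>(3)[rule_format, of Q] assms(3) by (simp add: face_of_refl)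
qed

text \<open>Vertices are the atoms of the face lattice. The face \<open>\<phi> {x}\<close> is
  nonempty, so it has an extreme point \<open>y\<close>; the inverse image of \<open>{y}\<close> is
  a nonempty face inside \<open>{x}\<close>, hence equal to it.\<close>

lemma face_lattice_iso_extreme_point:
  assumes iso: "face_lattice_iso \<phi> P Q" and Q: "compact Q" "convex Q"
    and x: "x extreme_point_of P"
  obtains y where "y extreme_point_of Q" "\<phi> {x} = {y}"
proof -
  obtain \<psi> where \<psi>: "face_lattice_iso \<psi> Q P"
      "\<forall>F. F face_of P \<longrightarrow> \<psi> (\<phi> F) = F" "\<forall>G. G face_of Q \<longrightarrow> \<phi> (\<psi> G) = G"
    by (rule face_lattice_iso_inverse[OF iso])
  have x_face: "{x} face_of P" using x by (simp add: face_of_singleton)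
  have face: "\<phi> {x} face_of Q" using iso x_face by (rule face_lattice_iso_face)
  have "\<phi> {x} \<noteq> {}"
    using \<psi>(2)[rule_format, OF x_face] face_lattice_iso_empty[OF \<psi>(1)] by auto
  then obtain y where y: "y extreme_point_of \<phi> {x}"
    using extreme_point_exists_convex face_of_imp_compact[OF Q(2,1) face] face_of_imp_convex[OF face]
    by blast
  then have yQ: "y extreme_point_of Q" "y \<in> \<phi> {x}"
    using extreme_point_of_face[OF face] by auto
  then have y_face: "{y} face_of Q" by (simp add: face_of_singleton)
  have "\<psi> {y} \<subseteq> \<psi> (\<phi> {x})"
    using face_lattice_iso_subset_iff[OF \<psi>(1) y_face face] yQ(2) by simp
  then have "\<psi> {y} \<subseteq> {x}" using \<psi>(2)[rule_format, OF x_face] by simp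
  moreover have "\<psi> {y} \<noteq> {}"
    using \<psi>(3)[rule_format, OF y_face] face_lattice_iso_empty[OF iso] by auto
  ultimately have "\<psi> {y} = {x}" by blast
  then have "\<phi> {x} = {y}" using \<psi>(3)[rule_format, OF y_face] by simp
  with yQ(1) show thesis by (rule that)
qed

lemma num_vertices_face_lattice_iso:
  assumes iso: "face_lattice_iso \<phi> P Q"
    and P: "compact P" "convex P" and Q: "compact Q" "convex Q"
  shows "num_vertices P = num_vertices Q"
proof -
  let ?E = "\<lambda>S. (\<lambda>v. {v}) ` {v. v extreme_point_of S}"
  obtain \<psi> where \<psi>: "face_lattice_iso \<psi> Q P"
      "\<forall>F. F face_of P \<longrightarrow> \<psi> (\<phi> F) = F" "\<forall>G. G face_of Q \<longrightarrow> \<phi> (\<psi> G) = G"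
    by (rule face_lattice_iso_inverse[OF iso])
  have "\<phi> ` ?E P = ?E Q"
  proof
    show "\<phi> ` ?E P \<subseteq> ?E Q"
    proof clarify
      fix x assume "x extreme_point_of P"
      then obtain y where "y extreme_point_of Q" "\<phi> {x} = {y}"
        by (rule face_lattice_iso_extreme_point[OF iso Q])
      then show "\<phi> {x} \<in> ?E Q" by auto
    qed
    show "?E Q \<subseteq> \<phi> ` ?E P"
    proof clarify
      fix y assume y: "y extreme_point_of Q"
      then obtain x where x: "x extreme_point_of P" "\<psi> {y} = {x}"
        by (rule face_lattice_iso_extreme_point[OF \<psi>(1) P])
      have "{y} = \<phi> {x}" using \<psi>(3)[rule_format, of "{y}"] y x(2) by (simp add: face_of_singleton)
      then show "{y} \<in> \<phi> ` ?E P" using x(1) by blast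
    qed
  qed
  moreover have "inj_on \<phi> (?E P)"
  proof (rule inj_on_subset)
    show "inj_on \<phi> {F. F face_of P}" using iso by (simp add: face_lattice_iso_def bij_betw_def)
  qed (auto simp: face_of_singleton)
  ultimately have "card (?E P) = card (?E Q)"
    using card_image by metis
  then show ?thesis
    unfolding num_vertices_def by (simp add: card_image inj_on_def)
qed

section \<open>Vertices under a linear projection\<close>

text \<open>A segment whose interior meets the fibre projects to one through \<open>w\<close>, which
  must degenerate to a point because \<open>w\<close> is extreme.\<close>

lemma extreme_point_of_linear_image_face:
  assumes \<pi>: "linear \<pi>" and w: "w extreme_point_of \<pi> ` P" and P: "convex P"
  shows "{x \<in> P. \<pi> x = w} face_of P"
  unfolding face_of_def
proof (intro conjI ballI impI)
  show "convex {x \<in> P. \<pi> x = w}"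
    using convexD[OF P] by (intro convexI) (auto simp: linear_add[OF \<pi>] linear_cmul[OF \<pi>] simp flip: scaleR_add_left)
  fix a b x
  assume a: "a \<in> P" and b: "b \<in> P" and x: "x \<in> {x \<in> P. \<pi> x = w}" "x \<in> open_segment a b"
  obtain u where u: "0 < u" "u < 1" "x = (1 - u) *\<^sub>R a + u *\<^sub>R b"
    using x(2) by (auto simp: in_segment)
  have \<pi>x: "w = (1 - u) *\<^sub>R \<pi> a + u *\<^sub>R \<pi> b"
    using x(1) u(3) by (simp add: linear_add[OF \<pi>] linear_cmul[OF \<pi>])
  have "\<pi> a = \<pi> b"
  proof (rule ccontr)
    assume "\<pi> a \<noteq> \<pi> b"
    then have "w \<in> open_segment (\<pi> a) (\<pi> b)" using \<pi>x u(1,2) unfolding in_segment by blast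
    then show False using w a b by (auto simp: extreme_point_of_def)
  qed
  moreover from this have "\<pi> a = w" using \<pi>x by (simp add: algebra_simps)
  ultimately show "a \<in> {x \<in> P. \<pi> x = w}" "b \<in> {x \<in> P. \<pi> x = w}" using a b by auto
qed auto

text \<open>Vertices of the image are images of vertices. If none were lost, \<open>\<pi>\<close>
  would be injective on the vertices and \<open>\<pi> v\<close> would be a vertex. Its fibre would
  be a face whose only vertex is \<open>v\<close>, so it could not contain
  \<open>v + y\<close>.\<close>

lemma num_vertices_linear_image_less:
  fixes P :: "'a::euclidean_space set" and \<pi> :: "'a \<Rightarrow> 'b::euclidean_space"
  assumes P: "polytope P" and \<pi>: "linear \<pi>"
    and v: "v extreme_point_of P" and y: "y \<noteq> 0" "\<pi> y = 0" "v + y \<in> P"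
  shows "num_vertices (\<pi> ` P) < num_vertices P"
proof (rule ccontr)
  let ?E = "{v. v extreme_point_of P}"
  assume neg: "\<not> ?thesis"
  have fin: "finite ?E"
    using finite_polyhedron_extreme_points[OF polytope_imp_polyhedron[OF P]] .
  have "P = convex hull ?E"
    using Krein_Milman_Minkowski polytope_imp_compact[OF P] polytope_imp_convex[OF P] by blast
  then have "\<pi> ` P = convex hull (\<pi> ` ?E)"
    by (metis convex_hull_linear_image[OF \<pi>])
  then have sub: "{w. w extreme_point_of \<pi> ` P} \<subseteq> \<pi> ` ?E"
    using extreme_point_of_convex_hull by fastforce
  have le: "card (\<pi> ` ?E) \<le> card ?E" using fin by (rule card_image_le)
  have "card ?E \<le> card {w. w extreme_point_of \<pi> ` P}"
    using neg by (simp add: num_vertices_def)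
  moreover have "card {w. w extreme_point_of \<pi> ` P} \<le> card (\<pi> ` ?E)"
    using fin sub by (intro card_mono) auto
  ultimately have eq: "card (\<pi> ` ?E) = card ?E" "card {w. w extreme_point_of \<pi> ` P} = card (\<pi> ` ?E)"
    using le by linarith+
  have inj: "inj_on \<pi> ?E" using eq_card_imp_inj_on[OF fin eq(1)] .
  have "{w. w extreme_point_of \<pi> ` P} = \<pi> ` ?E"
    using card_subset_eq[OF _ sub eq(2)] fin by simp
  then have "\<pi> v extreme_point_of \<pi> ` P" using v by blast
  then have face: "{x \<in> P. \<pi> x = \<pi> v} face_of P" (is "?G face_of P")
    using polytope_imp_convex[OF P] by (rule extreme_point_of_linear_image_face[OF \<pi>])
  have "{x. x extreme_point_of ?G} \<subseteq> {v}"
  proof clarify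
    fix x assume "x extreme_point_of ?G"
    then have "x extreme_point_of P" "\<pi> x = \<pi> v"
      using extreme_point_of_face[OF face] by auto
    then show "x = v" using inj v by (auto dest: inj_onD)
  qed
  moreover have "?G = convex hull {x. x extreme_point_of ?G}"
    using face_of_polytope_polytope[OF P face]
    by (intro Krein_Milman_Minkowski polytope_imp_compact polytope_imp_convex)
  ultimately have "?G \<subseteq> {v}"
    using hull_mono[of "{x. x extreme_point_of ?G}" "{v}" convex] by simp
  moreover have "v + y \<in> ?G" using y by (simp add: linear_add[OF \<pi>])
  ultimately show False using y(1) by auto
qed

section \<open>Transport of facets and vertices from the product to the polytope\<close>

theorem theorem2p6:
  fixes P :: "'a::euclidean_space set"
    and \<Delta> :: "(real ^ 'd) set"
    and \<pi> :: "'a \<Rightarrow> real ^ 'd"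
  assumes "CARD('d) \<ge> 2"
    and "polytope P"
    and "int CARD('d) simplex \<Delta>"
    and "combinatorially_equivalent P (fold_product \<Delta> :: ((real ^ 'd) ^ 'd) set)"
    and "linear \<pi>"
  shows "int (num_vertices (\<pi> ` P)) \<le> int (num_vertices P) - 1
    \<and> int (num_vertices P) - 1 = (int CARD('d) + 1) ^ CARD('d) - 1"
proof -
  obtain V where V: "\<not> affine_dependent V" "int (card V) = int CARD('d) + 1" "\<Delta> = convex hull V"
    using assms(3) unfolding simplex_def by blast
  have cardV: "card V = CARD('d) + 1" using V(2) by linarith
  have finV: "finite V" using V(1) by (rule aff_independent_finite)
  let ?Q = "fold_product \<Delta> :: ((real ^ 'd) ^ 'd) set"
  have Q: "compact ?Q" "convex ?Q"
    using assms(3) by (auto intro: compact_fold_product convex_fold_product compact_simplex convex_simplex)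
  have P: "compact P" "convex P"
    using assms(2) by (auto intro: polytope_imp_compact polytope_imp_convex)
  obtain \<phi> where \<phi>: "face_lattice_iso \<phi> P ?Q"
    using assms(4) unfolding combinatorially_equivalent_def face_lattice_iso_def by blast
  obtain \<psi> where \<psi>: "face_lattice_iso \<psi> ?Q P"
      "\<forall>F. F face_of P \<longrightarrow> \<psi> (\<phi> F) = F" "\<forall>G. G face_of ?Q \<longrightarrow> \<phi> (\<psi> G) = G"
    by (rule face_lattice_iso_inverse[OF \<phi>])
  have extQ: "{x. x extreme_point_of ?Q} = fold_product V"
    unfolding extreme_point_of_fold_product V(3) extreme_point_of_convex_hull_affine_independent[OF V(1)]
    by (simp add: fold_product_def)
  have numP: "num_vertices P = (CARD('d) + 1) ^ CARD('d)"
    unfolding num_vertices_face_lattice_iso[OF \<phi> P Q]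
    unfolding num_vertices_def extQ card_fold_product[OF finV] cardV ..
  \<comment> \<open>The facets of the product: coordinate \<open>i\<close> is confined to the facet
    of the simplex opposite the vertex \<open>j\<close>.\<close>
  define G where "G i j = {x \<in> ?Q. x $ i \<in> convex hull (V - {j})}" for i j
  have G: "G i j face_of ?Q" for i j
    unfolding G_def V(3)
    by (intro face_of_fold_product_slice convex_convex_hull)
       (use face_of_convex_hull_affine_independent[OF V(1)] in blast)
  \<comment> \<open>The vertex of \<open>P\<close> that corresponds to the vertex of the product
    with coordinates \<open>s i\<close>.\<close>
  define v where "v s = (SOME p. p extreme_point_of P \<and> \<psi> {\<chi> i. s i} = {p})" for s :: "'d \<Rightarrow> real ^ 'd"
  have v: "v s extreme_point_of P" "\<psi> {\<chi> i. s i} = {v s}" if "\<forall>i. s i \<in> V" for s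
  proof -
    have "(\<chi> i. s i) extreme_point_of ?Q"
      using that extQ by (auto simp: fold_product_def)
    then have "\<exists>p. p extreme_point_of P \<and> \<psi> {\<chi> i. s i} = {p}"
      using face_lattice_iso_extreme_point[OF \<psi>(1) P] by blast
    from someI_ex[OF this] show "v s extreme_point_of P" "\<psi> {\<chi> i. s i} = {v s}"
      unfolding v_def by auto
  qed
  \<comment> \<open>Affine independence keeps \<open>j\<close> out of the hull of the other
    vertices.\<close>
  have in_hull: "a \<in> convex hull (V - {j}) \<longleftrightarrow> a \<noteq> j" if "a \<in> V" "j \<in> V" for a j
  proof
    assume "a \<in> convex hull (V - {j})"
    then show "a \<noteq> j"
      using V(1) convex_hull_subset_affine_hull that unfolding affine_dependent_def by blast
  qed (use that in \<open>simp add: hull_inc\<close>)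
  obtain s y where s: "\<forall>i. s i \<in> V" and y: "y \<noteq> 0" "\<pi> y = 0" "v s + y \<in> P"
  proof (rule projection_fibre_nontrivial[OF assms(1,2) cardV, where F = "\<lambda>i j. \<psi> (G i j)" and v = v and \<pi> = \<pi>])
    show "\<psi> (G i j) face_of P" for i j
      using \<psi>(1) G by (rule face_lattice_iso_face)
    show "\<exists>i. \<exists>j\<in>V. C \<subseteq> \<psi> (G i j)" if C: "C face_of P" "C \<noteq> P" for C
    proof -
      have "\<phi> C \<noteq> ?Q"
        using \<psi>(2)[rule_format, OF C(1)] face_lattice_iso_top[OF \<psi>(1) Q(2) P(2)] C(2) by auto
      then obtain i j where "j \<in> V" "\<phi> C \<subseteq> G i j"
        using proper_face_of_fold_product_simplex[OF V(1), of "\<phi> C"] face_lattice_iso_face[OF \<phi> C(1)] cardV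
        unfolding G_def V(3) by auto
      then have "\<psi> (\<phi> C) \<subseteq> \<psi> (G i j)"
        using face_lattice_iso_subset_iff[OF \<psi>(1) face_lattice_iso_face[OF \<phi> C(1)] G] by blast
      then show ?thesis using \<psi>(2)[rule_format, OF C(1)] \<open>j \<in> V\<close> by auto
    qed
    show "v s \<in> P" if "\<forall>i. s i \<in> V" for s
      using v(1)[OF that] by (simp add: extreme_point_of_def)
    \<comment> \<open>Membership of a vertex is rewritten as inclusion of a singleton face, which
      the lattice isomorphism preserves.\<close>
    show "v s \<in> \<psi> (G i j) \<longleftrightarrow> j \<noteq> s i" if s: "\<forall>i. s i \<in> V" and j: "j \<in> V" for s i j
    proof -
      have sQ: "(\<chi> i. s i) extreme_point_of ?Q"
        using s extQ by (auto simp: fold_product_def)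
      then have "{v s} \<subseteq> \<psi> (G i j) \<longleftrightarrow> {\<chi> i. s i} \<subseteq> G i j"
        unfolding v(2)[OF s, symmetric]
        by (intro face_lattice_iso_subset_iff[OF \<psi>(1) _ G]) (simp add: face_of_singleton)
      also have "\<dots> \<longleftrightarrow> j \<noteq> s i"
        using sQ in_hull[of "s i" j] s j by (auto simp: G_def extreme_point_of_def)
      finally show ?thesis by simp
    qed
  qed (use assms(5) in auto)
  have "num_vertices (\<pi> ` P) < num_vertices P"
    using assms(2,5) v(1)[OF s] y by (rule num_vertices_linear_image_less)
  moreover have "int (num_vertices P) = (int CARD('d) + 1) ^ CARD('d)"
    by (simp add: numP add.commute)
  ultimately show ?thesis by linarith
qed

end
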